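(* Let $0<\gamma<1$, $T>0$, $b,d>0$ and $a=c=0$ (the "BBM-BBM" B/FD case). Let $\mu\ge 1$, and suppose that the 1-periodic initial-value problem for the B/FD system with initial data $(\zeta_0,u_0)$ has a unique solution $(\zeta,u)$ on $[0,T]$ with $\zeta,u\in C([0,T];H^{\mu})$. For an integer $N\ge1$ let $(\zeta_N,u_N)$ be the Fourier-Galerkin semidiscrete approximation in $S_N$. Then there exist $N_0$ and a constant $C$ independent of $N$ such that for all $N\ge N_0$ the semidiscrete solution $(\zeta_N,u_N)$ is defined on $[0,T]$ and $$\max_{0\le t\le T}\left(\|\zeta_N(t)-\zeta(t)\|+\|u_N(t)-u(t)\|\right)\le C N^{-\mu}.$$
   Context: B/FD (Boussinesq/Full dispersion) system, with constants $a=\frac{1-\alpha_1-3\beta}{3}$, $b=\frac{\alpha_1}{3}$, $c=\beta\alpha_2$, $d=\beta(1-\alpha_2)$, where $\alpha_1\ge0$, $\alpha_2\le1$, $\beta\ge0$: $$(1-b\partial_x^2)\zeta_t+\tfrac1\gamma((1-\zeta)u)_x-\tfrac1{\gamma^2}(|D|\coth|D|)u_x+\tfrac1\gamma\left(a-\tfrac1{\gamma^2}\coth^2|D|\right)u_{xxx}=0,$$ $$(1-d\partial_x^2)u_t+(1-\gamma)\zeta_x-\tfrac1\gamma uu_x+c(1-\gamma)\zeta_{xxx}=0,$$ with $D=\frac1i\partial_x$ and real-valued unknowns $\zeta(x,t),u(x,t)$ that are 1-periodic in $x$, with $\zeta(\cdot,0)=\zeta_0$, $u(\cdot,0)=u_0$.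 For a 1-periodic $f$ let $\widehat f(k)=\int_0^1 f(x)e^{-2\pi i kx}dx$, $k\in\mathbb Z$. $\|\cdot\|$ is the norm of $L^2(0,1)$, and $H^s$ is the Sobolev space of 1-periodic functions with norm $\|f\|_s=\left(\sum_{k\in\mathbb Z}(1+k^2)^s|\widehat f(k)|^2\right)^{1/2}$. Put $\kappa=2\pi k$ and $$g(\kappa)=\tfrac1\gamma-\tfrac1{\gamma^2}|\kappa|\coth|\kappa|-\tfrac{a\kappa^2}{\gamma}+\tfrac{\kappa^2}{\gamma^3}\coth^2|\kappa|\quad(\kappa\ne0),$$ extended by continuity to $\kappa=0$ (so $g(0)=\frac1\gamma-\frac1{\gamma^2}+\frac1{\gamma^3}$). In Fourier form the initial-value problem reads, for all $k\in\mathbb Z$, $t\in[0,T]$, $$\widehat\zeta_t+\frac{i\kappa}{1+b\kappa^2}g(\kappa)\widehat u=\frac{i}{\gamma}\frac{\kappa}{1+b\kappa^2}\widehat{\zeta u},\qquad \widehat u_t+i\kappa\frac{(1-\gamma)(1-c\kappa^2)}{1+d\kappa^2}\widehat\zeta=\frac{i}{2\gamma}\frac{\kappa}{1+d\kappa^2}\widehat{u^2},$$ with $\widehat\zeta(k,0)=\widehat{\zeta_0}(k)$, $\widehat u(k,0)=\widehat{u_0}(k)$. $S_N=\mathrm{span}\{e^{2\pi ikx}:k\in\mathbb Z,\ -N\le k\le N\}$. The Fourier-Galerkin semidiscrete approximation is the solution $(\zeta_N(t),u_N(t))\in S_N\times S_N$ of the ODE system obtained by imposing the same Fourier equations for $(\zeta_N,u_N)$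 in place of $(\zeta,u)$ only for $-N\le k\le N$, with $\widehat{\zeta_N}(k,0)=\widehat{\zeta_0}(k)$, $\widehat{u_N}(k,0)=\widehat{u_0}(k)$ for $-N\le k\le N$. *)

theory Defs
  imports "HOL-Analysis.Analysis"
begin

section \<open>Periodic functions, Fourier coefficients and Sobolev norms\<close>

text \<open>Elements of $L^2(0,1)$ and $H^s$ are represented by functions defined everywhere; equality
  of such elements is equality almost everywhere.\<close>

definition periodic_L2 :: "(real \<Rightarrow> complex) \<Rightarrow> bool" where
  "periodic_L2 f \<longleftrightarrow>
     (\<forall>x. f (x + 1) = f x) \<and> f \<in> borel_measurable lebesgue \<and>
     set_integrable lebesgue {0..1} (\<lambda>x. (cmod (f x))\<^sup>2)"

definition L2_norm :: "(real \<Rightarrow> complex) \<Rightarrow> real" where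
  "L2_norm f = sqrt (LINT x:{0..1}|lebesgue. (cmod (f x))\<^sup>2)"

definition fourier_mode :: "int \<Rightarrow> real \<Rightarrow> complex" where
  "fourier_mode k x = exp (2 * of_real pi * \<i> * of_int k * of_real x)"

definition fourier :: "(real \<Rightarrow> complex) \<Rightarrow> int \<Rightarrow> complex" where
  "fourier f k =
     (LINT x:{0..1}|lebesgue. f x * exp (- (2 * of_real pi * \<i> * of_int k * of_real x)))"

text \<open>Only used for $s \ge 0$, where $H^s \subseteq L^2$.\<close>

definition sobolev :: "real \<Rightarrow> (real \<Rightarrow> complex) set" where
  "sobolev s = {f. periodic_L2 f \<and>
     (\<lambda>k::int. (1 + (of_int k)\<^sup>2) powr s * (cmod (fourier f k))\<^sup>2) summable_on UNIV}"

definition sobolev_norm :: "real \<Rightarrow> (real \<Rightarrow> complex) \<Rightarrow> real" where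
  "sobolev_norm s f =
     sqrt (\<Sum>\<^sub>\<infinity>k::int. (1 + (of_int k)\<^sup>2) powr s * (cmod (fourier f k))\<^sup>2)"

definition continuous_in_sobolev :: "real \<Rightarrow> real \<Rightarrow> (real \<Rightarrow> real \<Rightarrow> complex) \<Rightarrow> bool" where
  "continuous_in_sobolev T s f \<longleftrightarrow>
     (\<forall>t\<in>{0..T}. f t \<in> sobolev s) \<and>
     (\<forall>t\<in>{0..T}. ((\<lambda>r. sobolev_norm s (\<lambda>x. f r x - f t x)) \<longlongrightarrow> 0) (at t within {0..T}))"

section \<open>The B/FD system\<close>

definition coth :: "real \<Rightarrow> real" where
  "coth x = cosh x / sinh x"

text \<open>The value at $0$ is the limit as $\kappa \to 0$.\<close>

definition g_symbol :: "real \<Rightarrow> real \<Rightarrow> real \<Rightarrow> real" where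
  "g_symbol \<gamma> a \<kappa> =
     (if \<kappa> = 0 then 1/\<gamma> - 1/\<gamma>^2 + 1/\<gamma>^3
      else 1/\<gamma> - 1/\<gamma>^2 * \<bar>\<kappa>\<bar> * coth \<bar>\<kappa>\<bar> - a * \<kappa>^2 / \<gamma> + \<kappa>^2 / \<gamma>^3 * (coth \<bar>\<kappa>\<bar>)^2)"

text \<open>The initial-value problem in Fourier form, imposed on the wave numbers in \<open>K\<close> only:
  \<open>K = UNIV\<close> gives the full problem, \<open>K = {-N..N}\<close> the Galerkin system. The linear terms
  are moved to the right-hand side. At the endpoints of $[0,T]$ the time derivative is
  one-sided.\<close>

definition BFD_fourier_ivp ::
  "real \<Rightarrow> real \<Rightarrow> real \<Rightarrow> real \<Rightarrow> real \<Rightarrow> int set \<Rightarrow> real \<Rightarrow> (real \<Rightarrow> complex) \<Rightarrow> (real \<Rightarrow> complex) \<Rightarrow>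
   (real \<Rightarrow> real \<Rightarrow> complex) \<Rightarrow> (real \<Rightarrow> real \<Rightarrow> complex) \<Rightarrow> bool" where
  "BFD_fourier_ivp \<gamma> a b c d K T \<zeta>\<^sub>0 u\<^sub>0 \<zeta> u \<longleftrightarrow>
     (\<forall>k\<in>K.
        fourier (\<zeta> 0) k = fourier \<zeta>\<^sub>0 k \<and> fourier (u 0) k = fourier u\<^sub>0 k \<and>
        (let \<kappa> = 2 * pi * real_of_int k in
         \<forall>t\<in>{0..T}.
           ((\<lambda>s. fourier (\<zeta> s) k) has_vector_derivative
              \<i> / of_real \<gamma> * of_real (\<kappa> / (1 + b * \<kappa>^2)) * fourier (\<lambda>x. \<zeta> t x * u t x) k
              - \<i> * of_real (\<kappa> / (1 + b * \<kappa>^2) * g_symbol \<gamma> a \<kappa>) * fourier (u t) k)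
             (at t within {0..T}) \<and>
           ((\<lambda>s. fourier (u s) k) has_vector_derivative
              \<i> / (2 * of_real \<gamma>) * of_real (\<kappa> / (1 + d * \<kappa>^2)) * fourier (\<lambda>x. (u t x)^2) k
              - \<i> * of_real (\<kappa> * ((1 - \<gamma>) * (1 - c * \<kappa>^2) / (1 + d * \<kappa>^2))) * fourier (\<zeta> t) k)
             (at t within {0..T})))"

text \<open>Real-valued solutions on $[0,T]$ in $C([0,T];H^\mu)$.\<close>

definition BFD_solution ::
  "real \<Rightarrow> real \<Rightarrow> real \<Rightarrow> real \<Rightarrow> real \<Rightarrow> real \<Rightarrow> real \<Rightarrow> (real \<Rightarrow> real) \<Rightarrow> (real \<Rightarrow> real) \<Rightarrow>
   (real \<Rightarrow> real \<Rightarrow> real) \<Rightarrow> (real \<Rightarrow> real \<Rightarrow> real) \<Rightarrow> bool" where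
  "BFD_solution \<gamma> a b c d \<mu> T \<zeta>\<^sub>0 u\<^sub>0 \<zeta> u \<longleftrightarrow>
     continuous_in_sobolev T \<mu> (\<lambda>t x. of_real (\<zeta> t x)) \<and>
     continuous_in_sobolev T \<mu> (\<lambda>t x. of_real (u t x)) \<and>
     BFD_fourier_ivp \<gamma> a b c d UNIV T (\<lambda>x. of_real (\<zeta>\<^sub>0 x)) (\<lambda>x. of_real (u\<^sub>0 x))
       (\<lambda>t x. of_real (\<zeta> t x)) (\<lambda>t x. of_real (u t x))"

definition BFD_unique_solution ::
  "real \<Rightarrow> real \<Rightarrow> real \<Rightarrow> real \<Rightarrow> real \<Rightarrow> real \<Rightarrow> real \<Rightarrow> (real \<Rightarrow> real) \<Rightarrow> (real \<Rightarrow> real) \<Rightarrow>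
   (real \<Rightarrow> real \<Rightarrow> real) \<Rightarrow> (real \<Rightarrow> real \<Rightarrow> real) \<Rightarrow> bool" where
  "BFD_unique_solution \<gamma> a b c d \<mu> T \<zeta>\<^sub>0 u\<^sub>0 \<zeta> u \<longleftrightarrow>
     BFD_solution \<gamma> a b c d \<mu> T \<zeta>\<^sub>0 u\<^sub>0 \<zeta> u \<and>
     (\<forall>\<zeta>' u'. BFD_solution \<gamma> a b c d \<mu> T \<zeta>\<^sub>0 u\<^sub>0 \<zeta>' u' \<longrightarrow>
        (\<forall>t\<in>{0..T}. AE x in lebesgue. \<zeta>' t x = \<zeta> t x \<and> u' t x = u t x))"

section \<open>The Fourier--Galerkin semidiscretization\<close>

text \<open>The complex span of the modes $e^{2\pi i k x}$, $-N \le k \le N$.\<close>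

definition trig_space :: "nat \<Rightarrow> (real \<Rightarrow> complex) set" where
  "trig_space N = {f. \<exists>c. f = (\<lambda>x. \<Sum>k\<in>{- int N..int N}. c k * fourier_mode k x)}"

definition galerkin_solution ::
  "real \<Rightarrow> real \<Rightarrow> real \<Rightarrow> real \<Rightarrow> real \<Rightarrow> nat \<Rightarrow> real \<Rightarrow> (real \<Rightarrow> real) \<Rightarrow> (real \<Rightarrow> real) \<Rightarrow>
   (real \<Rightarrow> real \<Rightarrow> complex) \<Rightarrow> (real \<Rightarrow> real \<Rightarrow> complex) \<Rightarrow> bool" where
  "galerkin_solution \<gamma> a b c d N T \<zeta>\<^sub>0 u\<^sub>0 \<zeta>\<^sub>N u\<^sub>N \<longleftrightarrow>
     (\<forall>t\<in>{0..T}. \<zeta>\<^sub>N t \<in> trig_space N \<and> u\<^sub>N t \<in> trig_space N) \<and>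
     BFD_fourier_ivp \<gamma> a b c d {- int N..int N} T (\<lambda>x. of_real (\<zeta>\<^sub>0 x)) (\<lambda>x. of_real (u\<^sub>0 x))
       \<zeta>\<^sub>N u\<^sub>N"

end

theory Submission
  imports Defs "HOL-Probability.Discrete_Topology"
begin

text \<open>
  The linear part of the system is skew for the energy
  $E = \sum_{|k| \le N} |\widehat\zeta - \widehat{\zeta_N}|^2 + w_k |\widehat u - \widehat{u_N}|^2$
  with the symmetrizer $w_k = g(\kappa) (1 + d\kappa^2) / ((1 + b\kappa^2)(1 - \gamma))$,
  which is of size $1 + k^2$, so that $E$ controls the $H^1$ norm of the error in $u$. Since $b, d > 0$,
  the nonlinear terms are bounded in this energy through
  $|\sum_k c_k (A * B)_k| \le \|c\|_{\ell^2} \|A\|_{\ell^2} \|B\|_{\ell^1}$, and the truncation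
  error is $\delta = O(N^{-2\mu})$. Hence $E' \le K (\delta + E)$ as long as $E < 1$, and a
  bootstrap gives $E = O(N^{-2\mu})$ on all of $[0,T]$. Existence of the semidiscrete solution
  follows by truncating the nonlinearity: the same bound shows that the solution of the truncated
  system never leaves the region where the truncation is inactive. All this takes place on Fourier
  coefficients; for $\mu \ge 1$ these are absolutely summable, and completeness of the trigonometric
  system (via Stone-Weierstrass on the circle) identifies a function with its Fourier series.
\<close>

section \<open>Absolutely convergent Fourier series\<close>

text \<open>The obstacle is the squared \<open>coth\<close> term: for \<open>a = 0\<close> the
  symbol g still grows like \<kappa>^2, so the multiplier of u in the \<zeta> equation grows like
  |\<kappa>| and a plain L^2 estimate would lose a factor of order N. Weighting the u error by w
  trades this loss for an H^1 norm; the u equation can afford the weight because its nonlinear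
  multiplier decays like 1/|\<kappa>|. The \<zeta> error, however, is controlled in L^2 only, which
  gives no l^1 bound uniform in N for the coefficients of the approximate \<zeta>. Hence products
  are split so that the l^1 factors are the exact solution and the approximate u, as in \<zeta> u -
  \<zeta>_N u_N = \<zeta> (u - u_N) + u_N (\<zeta> - \<zeta>_N). The l^1 norm of u_N is bounded as
  long as the energy is below 1, which is the reason for the bootstrap. The linear part is diagonal
  in k, so truncation error enters through the convolutions alone, and the energy starts at 0
  because the initial data are truncated exactly.\<close>

abbreviation unit_measure :: "real measure" where
  "unit_measure \<equiv> lebesgue_on {0..1}"

lemma set_integral_unit:
  "set_lebesgue_integral lebesgue {0..1::real} (f :: real \<Rightarrow> 'a::{banach,second_countable_topology})
     = integral\<^sup>L unit_measure f"
  unfolding set_lebesgue_integral_def by (subst integral_restrict_space) auto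

lemma set_integrable_unit:
  "set_integrable lebesgue {0..1::real} (f :: real \<Rightarrow> 'a::{banach,second_countable_topology})
     \<longleftrightarrow> integrable unit_measure f"
  unfolding set_integrable_def by (subst integrable_restrict_space) auto

interpretation unit_measure: finite_measure unit_measure
  by (rule finite_measureI) (simp add: emeasure_restrict_space)

lemma measure_unit [simp]: "measure unit_measure {0..1} = 1"
  by (simp add: measure_restrict_space)

lemma fourier_unit: "fourier f k = (\<integral>x. f x * fourier_mode (-k) x \<partial>unit_measure)"
  unfolding fourier_def set_integral_unit fourier_mode_def by (simp add: mult_ac)

lemma norm_fourier_mode [simp]: "cmod (fourier_mode k x) = 1"
  unfolding fourier_mode_def
  by simp

lemma fourier_mode_add: "fourier_mode (k + l) x = fourier_mode k x * fourier_mode l x"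
  unfolding fourier_mode_def by (simp add: exp_add [symmetric] algebra_simps)

lemma fourier_mode_0 [simp]: "fourier_mode 0 x = 1"
  by (simp add: fourier_mode_def)

lemma cnj_fourier_mode: "cnj (fourier_mode k x) = fourier_mode (-k) x"
  unfolding fourier_mode_def by (simp add: exp_cnj)

lemma exp_2pi_eq: "exp (of_int (2 * m) * of_real pi * \<i>) = 1"
proof -
  have "exp (of_int (2 * m) * of_real pi * \<i>) = cis (2 * pi * m)"
    unfolding cis_conv_exp by (simp add: mult_ac)
  also have "\<dots> = 1"
    by (simp add: complex_eq_iff cos_int_2pin sin_int_2pin)
  finally show ?thesis .
qed

lemma fourier_mode_of_int: "fourier_mode k (of_int n) = 1"
proof -
  have "fourier_mode k (of_int n) = exp (of_int (2 * (k * n)) * of_real pi * \<i>)"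
    by (simp add: fourier_mode_def mult_ac)
  also have "\<dots> = 1"
    by (rule exp_2pi_eq)
  finally show ?thesis .
qed

lemma continuous_fourier_mode: "continuous_on S (fourier_mode k)"
  unfolding fourier_mode_def by (intro continuous_intros)

lemma borel_measurable_fourier_mode [measurable]:
  "fourier_mode k \<in> borel_measurable lebesgue" "fourier_mode k \<in> borel_measurable unit_measure"
proof -
  show "fourier_mode k \<in> borel_measurable unit_measure"
    by (rule continuous_imp_measurable_on_sets_lebesgue[OF continuous_fourier_mode]) simp
  have "fourier_mode k \<in> borel_measurable (lebesgue_on UNIV)"
    by (rule continuous_imp_measurable_on_sets_lebesgue[OF continuous_fourier_mode]) simp
  then show "fourier_mode k \<in> borel_measurable lebesgue" by (simp add: lebesgue_on_UNIV_eq)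
qed

lemma integral_fourier_mode: "(\<integral>x. fourier_mode k x \<partial>unit_measure) = (if k = 0 then 1 else 0)"
proof (cases "k = 0")
  case True
  then show ?thesis by simp
next
  case False
  define c :: complex where "c = 2 * of_real pi * \<i> * of_int k"
  have c: "c \<noteq> 0" using False by (simp add: c_def)
  have m: "fourier_mode k x = exp (c * of_real x)" for x by (simp add: fourier_mode_def c_def)
  have D: "((\<lambda>x::real. exp (c * of_real x) / c) has_vector_derivative exp (c * of_real x)) (at x within {0..1})" for x
    using c by (auto intro!: derivative_eq_intros has_vector_derivative_real_field)
  have "(fourier_mode k has_integral (exp (c * of_real 1) / c - exp (c * of_real 0) / c)) {0..1}"
    unfolding m [abs_def] by (rule fundamental_theorem_of_calculus) (use D in auto)
  moreover have "exp (c * of_real 1) = 1" using m[of 1] fourier_mode_of_int[of k 1] by simp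
  ultimately have hi: "(fourier_mode k has_integral 0) {0..1}" by simp
  have "integrable unit_measure (fourier_mode k)"
    by (rule unit_measure.integrable_const_bound[of _ 1]) auto
  then have "(\<integral>x. fourier_mode k x \<partial>unit_measure) = integral {0..1} (fourier_mode k)"
    by (rule lebesgue_integral_eq_integral) simp
  with hi False show ?thesis by (simp add: integral_unique)
qed

lemma integrable_unit_mult_bounded:
  fixes f g :: "real \<Rightarrow> complex"
  assumes "integrable unit_measure f" "g \<in> borel_measurable unit_measure" "\<And>x. x \<in> {0..1} \<Longrightarrow> cmod (g x) \<le> B"
  shows "integrable unit_measure (\<lambda>x. f x * g x)"
proof (rule Bochner_Integration.integrable_bound[where f = "\<lambda>x. B * cmod (f x)"])
  show "integrable unit_measure (\<lambda>x. B * cmod (f x))" using assms(1) by simp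
  show "(\<lambda>x. f x * g x) \<in> borel_measurable unit_measure"
    using assms by (intro borel_measurable_times) auto
  show "AE x in unit_measure. cmod (f x * g x) \<le> norm (B * cmod (f x))"
  proof (rule AE_I2)
    fix x assume "x \<in> space unit_measure"
    then have "cmod (g x) \<le> B" by (auto intro: assms(3))
    then have "cmod (f x) * cmod (g x) \<le> cmod (f x) * \<bar>B\<bar>"
      by (intro mult_left_mono) auto
    then show "cmod (f x * g x) \<le> norm (B * cmod (f x))"
      by (simp add: norm_mult abs_mult mult.commute)
  qed
qed

section \<open>Completeness of the trigonometric system\<close>

inductive trig_poly :: "(real \<Rightarrow> complex) \<Rightarrow> bool" where
  mode: "trig_poly (\<lambda>x. c * fourier_mode k x)"
| add: "trig_poly f \<Longrightarrow> trig_poly g \<Longrightarrow> trig_poly (\<lambda>x. f x + g x)"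

lemma trig_poly_mult:
  assumes "trig_poly f" "trig_poly g"
  shows "trig_poly (\<lambda>x. f x * g x)"
  using assms(1)
proof induction
  case (mode c k)
  from assms(2) show ?case
  proof induction
    case (mode d l)
    have "trig_poly (\<lambda>x. (c * d) * fourier_mode (k + l) x)" by (rule trig_poly.mode)
    then show ?case by (simp add: fourier_mode_add mult_ac)
  next
    case (add f g)
    from trig_poly.add[OF add.IH] show ?case by (simp add: algebra_simps)
  qed
next
  case (add f g)
  from trig_poly.add[OF add.IH] show ?case by (simp add: algebra_simps)
qed

lemma fourier_mode_cis: "fourier_mode k x = cis (2 * pi * k * x)"
  unfolding fourier_mode_def cis_conv_exp by (simp add: mult_ac)

text \<open>The case with content is the linear one: on the circle a real-linear functional f is
  f(1) cos + f(i) sin, a combination of the modes 1 and -1. Products add frequencies, so the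
  remaining cases of the induction follow.\<close>

lemma trig_poly_real_polynomial:
  assumes "real_polynomial_function p"
  shows "trig_poly (\<lambda>x. of_real (p (cis (2 * pi * x))))"
  using assms
proof induction
  case (linear f)
  then interpret bounded_linear f .
  have f: "f z = Re z * f 1 + Im z * f \<i>" for z
  proof -
    have "z = Re z *\<^sub>R 1 + Im z *\<^sub>R \<i>" by (simp add: complex_eq_iff)
    then have "f z = f (Re z *\<^sub>R 1 + Im z *\<^sub>R \<i>)" by simp
    also have "\<dots> = Re z * f 1 + Im z * f \<i>" unfolding add scaleR by simp
    finally show ?thesis .
  qed
  have "trig_poly (\<lambda>x. (of_real (f 1) / 2 + of_real (f \<i>) / (2 * \<i>)) * fourier_mode 1 x
      + (of_real (f 1) / 2 - of_real (f \<i>) / (2 * \<i>)) * fourier_mode (-1) x)"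
    by (intro trig_poly.intros)
  also have "(\<lambda>x. (of_real (f 1) / 2 + of_real (f \<i>) / (2 * \<i>)) * fourier_mode 1 x
      + (of_real (f 1) / 2 - of_real (f \<i>) / (2 * \<i>)) * fourier_mode (-1) x)
      = (\<lambda>x. complex_of_real (f (cis (2 * pi * x))))"
    by (rule ext, subst f) (simp add: fourier_mode_cis complex_eq_iff Re_divide Im_divide power2_eq_square algebra_simps)
  finally show ?case .
next
  case (const c)
  show ?case using trig_poly.mode[of "of_real c" 0] by simp
next
  case (add f g)
  from trig_poly.add[OF add.IH] show ?case by simp
next
  case (mult f g)
  from trig_poly_mult[OF mult.IH] show ?case by simp
qed

lemma trig_poly_polynomial:
  fixes p :: "complex \<Rightarrow> complex"
  assumes "polynomial_function p"
  shows "trig_poly (\<lambda>x. p (cis (2 * pi * x)))"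
proof -
  have "real_polynomial_function (\<lambda>z. Re (p z))" "real_polynomial_function (\<lambda>z. Im (p z))"
    using assms bounded_linear_Re bounded_linear_Im unfolding polynomial_function_def o_def by blast+
  then have "trig_poly (\<lambda>x. of_real (Re (p (cis (2 * pi * x))))
      + \<i> * fourier_mode 0 x * of_real (Im (p (cis (2 * pi * x)))))"
    by (intro trig_poly.add trig_poly_mult trig_poly.mode trig_poly_real_polynomial)
  then show ?thesis by (simp flip: complex_eq)
qed

lemma trig_poly_orthogonal:
  assumes "trig_poly q" "integrable unit_measure f" "\<And>k. fourier f k = 0"
  shows "q \<in> borel_measurable unit_measure \<and> integrable unit_measure (\<lambda>x. f x * q x) \<and>
    (\<integral>x. f x * q x \<partial>unit_measure) = 0"
  using assms(1)
proof induction
  case (mode c k)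
  have "integrable unit_measure (\<lambda>x. f x * fourier_mode k x)"
    by (rule integrable_unit_mult_bounded[OF assms(2), where B = 1]) auto
  moreover have "(\<integral>x. f x * fourier_mode k x \<partial>unit_measure) = 0"
    using assms(3)[of "-k"] by (simp add: fourier_unit)
  ultimately show ?case by (simp add: mult.left_commute[of _ c] )
next
  case (add g h)
  then show ?case by (simp add: distrib_left borel_measurable_add)
qed

text \<open>A continuous \<open>g\<close> with equal end values descends to a continuous function
  \<open>h\<close> on the unit circle, where Stone-Weierstrass gives uniform approximation by
  polynomials, that is, by trigonometric polynomials. As \<open>f\<close> is only integrable, the
  uniform error \<open>e\<close> costs at most \<open>e\<close> times the integral of |f|.\<close>

lemma orthogonal_continuous:
  assumes f: "integrable unit_measure f" "\<And>k. fourier f k = 0"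
    and g: "continuous_on {0..1} g" "g 0 = g 1"
  shows "(\<integral>x. f x * g x \<partial>unit_measure) = 0"
proof -
  define h where "h = g \<circ> (\<lambda>z. Arg2pi z / (2 * pi))"
  \<comment> \<open>The constant homotopy of the loop \<open>g\<close> to itself; it serves to make
    the induced map on the circle, which is \<open>h\<close>, continuous.\<close>
  have "homotopic_loops UNIV g g"
    using g by (simp add: homotopic_loops_refl path_def pathfinish_def pathstart_def)
  then have "continuous_on (sphere 0 1) h"
    unfolding h_def using homotopic_with_imp_continuous[OF homotopic_loops_imp_homotopic_circlemaps, of UNIV g g] by simp
  have hg: "h (cis (2 * pi * x)) = g x" if "x \<in> {0..1}" for x
  proof (cases "x = 1")
    case True
    have "cis (2 * pi) = 1" by (simp add: complex_eq_iff)
    with True show ?thesis using Arg2pi_of_real[of 1] by (simp add: h_def g)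
  next
    case False
    then have "Arg2pi (cis (2 * pi * x)) = 2 * pi * x"
      using that by (intro Arg2pi_unique[of 1]) (auto simp: cis_conv_exp)
    then show ?thesis by (simp add: h_def)
  qed
  have gm: "g \<in> borel_measurable unit_measure"
    by (rule continuous_imp_measurable_on_sets_lebesgue) (use g in auto)
  obtain B where B: "\<And>x. x \<in> {0..1} \<Longrightarrow> cmod (g x) \<le> B"
    using compact_imp_bounded[OF compact_continuous_image[OF g(1) compact_Icc]] unfolding bounded_iff by blast
  have fg: "integrable unit_measure (\<lambda>x. f x * g x)"
    by (rule integrable_unit_mult_bounded[OF f(1) gm B])
  define I where "I = (\<integral>x. cmod (f x) \<partial>unit_measure)"
  have I: "I \<ge> 0" by (simp add: I_def)
  have "cmod (\<integral>x. f x * g x \<partial>unit_measure) \<le> e * I" if e: "e > 0" for e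
  proof -
    obtain p where p: "polynomial_function p" "\<And>z. z \<in> sphere 0 1 \<Longrightarrow> cmod (h z - p z) < e"
      using Stone_Weierstrass_polynomial_function[OF _ \<open>continuous_on (sphere 0 1) h\<close> e] by auto
    define q where "q x = p (cis (2 * pi * x))" for x
    have q: "q \<in> borel_measurable unit_measure" "integrable unit_measure (\<lambda>x. f x * q x)"
      "(\<integral>x. f x * q x \<partial>unit_measure) = 0"
      using trig_poly_orthogonal[OF trig_poly_polynomial[OF p(1)] f] by (auto simp: q_def [abs_def])
    have "(\<integral>x. f x * g x \<partial>unit_measure) = (\<integral>x. f x * g x - f x * q x \<partial>unit_measure)"
      using fg q by simp
    also have "cmod \<dots> \<le> (\<integral>x. cmod (f x * g x - f x * q x) \<partial>unit_measure)"
      by simp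
    also have "\<dots> \<le> (\<integral>x. e * cmod (f x) \<partial>unit_measure)"
    proof (rule integral_mono)
      show "integrable unit_measure (\<lambda>x. cmod (f x * g x - f x * q x))" using fg q by simp
      show "integrable unit_measure (\<lambda>x. e * cmod (f x))" using f by simp
      fix x assume "x \<in> space unit_measure"
      then have "cmod (g x - q x) \<le> e" using p(2)[of "cis (2 * pi * x)"] hg[of x]
        by (simp add: q_def less_imp_le)
      then show "cmod (f x * g x - f x * q x) \<le> e * cmod (f x)"
        using mult_left_mono[of "cmod (g x - q x)" e "cmod (f x)"]
        by (simp add: right_diff_distrib [symmetric] norm_mult mult.commute[of e])
    qed
    finally show ?thesis by (simp add: I_def)
  qed
  then have "cmod (\<integral>x. f x * g x \<partial>unit_measure) \<le> 0 + e" if "e > 0" for e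
  proof -
    have "cmod (\<integral>x. f x * g x \<partial>unit_measure) \<le> e / (I + 1) * I"
      by (rule \<open>\<And>e. e > 0 \<Longrightarrow> _ \<le> e * I\<close>) (use that I in simp)
    also have "\<dots> \<le> e" using that I by (simp add: field_simps)
    finally show ?thesis by simp
  qed
  then have "cmod (\<integral>x. f x * g x \<partial>unit_measure) \<le> 0" by (rule field_le_epsilon)
  then show ?thesis by simp
qed

text \<open>Testing against the conjugate phase \<open>s\<close> of \<open>f\<close> gives the
  integral of |f|. As \<open>s\<close> is merely measurable, it is replaced by continuous
  \<open>h n\<close> that are bounded by 1 and vanish at both endpoints, which makes them admissible
  for \<open>orthogonal_continuous\<close>; dominated convergence with majorant |f| passes to the
  limit.\<close>

lemma fourier_zero_imp_AE_zero:
  assumes f: "integrable unit_measure f" "\<And>k. fourier f k = 0"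
  shows "AE x in unit_measure. f x = 0"
proof -
  define s where "s x = cnj (sgn (f x))" for x
  have fm [measurable]: "f \<in> borel_measurable unit_measure" using f(1) by auto
  have sm [measurable]: "s \<in> borel_measurable unit_measure"
  proof -
    have "(\<lambda>z::complex. cnj z) \<in> borel_measurable borel"
      by (intro borel_measurable_continuous_onI continuous_intros)
    moreover have "(\<lambda>z::complex. sgn z) \<in> borel_measurable borel"
      unfolding sgn_div_norm by measurable
    ultimately show ?thesis
      using measurable_compose[OF measurable_compose[OF fm]] unfolding s_def by blast
  qed
  then have "s measurable_on {0..1}"
    by (subst measurable_on_iff_borel_measurable) auto
  then obtain N g where N: "negligible N" and gc: "\<And>n. continuous_on UNIV (g n)"
    and gl: "\<And>x. x \<notin> N \<Longrightarrow> (\<lambda>n. g n x) \<longlonglongrightarrow> (if x \<in> {0..1} then s x else 0)"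
    unfolding measurable_on_def by blast
  \<comment> \<open>The factor \<open>\<phi> n\<close> is 0 at 0 and 1 and equals 1 at every
    interior point for large n. The projection onto the unit disc enforces the bound without moving
    the limit \<open>s x\<close>, which lies in the disc.\<close>
  define \<phi> where "\<phi> n x = complex_of_real (min 1 (real n * (x * (1 - x))))" for n x
  define h where "h n x = \<phi> n x * closest_point (cball 0 1) (g n x)" for n x
  have cl: "cmod (closest_point (cball 0 1) z) \<le> 1" for z :: complex
    using closest_point_in_set[of "cball 0 1" z] by auto
  have hc: "continuous_on {0..1} (h n)" for n
    unfolding h_def \<phi>_def
    by (intro continuous_intros continuous_on_compose2[OF continuous_on_closest_point[of "cball 0 1"]]
        continuous_on_subset[OF gc]) auto
  have hm [measurable]: "h n \<in> borel_measurable unit_measure" for n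
    by (rule continuous_imp_measurable_on_sets_lebesgue) (use hc in auto)
  have hb: "cmod (h n x) \<le> 1" if "x \<in> {0..1}" for n x
  proof -
    have "cmod (\<phi> n x) \<le> 1" using that by (auto simp: \<phi>_def abs_le_iff simp flip: of_real_mult of_nat_mult)
    with cl show ?thesis unfolding h_def norm_mult by (simp add: mult_le_one)
  qed
  have "AE x in unit_measure. x \<notin> N \<union> {0,1}"
  proof -
    have "AE x in lebesgue. x \<notin> N \<union> {0,1}"
      by (rule AE_not_in) (use N in \<open>auto simp: negligible_iff_null_sets intro!: null_sets.Un\<close>)
    then show ?thesis by (auto simp: AE_restrict_space_iff)
  qed
  then have "AE x in unit_measure. (\<lambda>n. f x * h n x) \<longlonglongrightarrow> f x * s x"
  proof (rule AE_mp, intro AE_I2 impI)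
    fix x assume x: "x \<in> space unit_measure" "x \<notin> N \<union> {0,1}"
    then have x01: "0 < x" "x < 1" by auto
    have "(\<lambda>n. g n x) \<longlonglongrightarrow> s x" using gl[of x] x by simp
    then have "(\<lambda>n. closest_point (cball 0 1) (g n x)) \<longlonglongrightarrow> closest_point (cball 0 1) (s x)"
      by (intro isCont_tendsto_compose[OF continuous_at_closest_point]) auto
    also have "closest_point (cball 0 1) (s x) = s x"
      by (rule closest_point_self) (simp add: s_def norm_sgn)
    finally have 1: "(\<lambda>n. closest_point (cball 0 1) (g n x)) \<longlonglongrightarrow> s x" .
    have "\<forall>\<^sub>F n in sequentially. real n \<ge> 1 / (x * (1 - x))"
      by (rule eventually_ge_at_top[THEN filterlim_real_sequentially[unfolded filterlim_iff, rule_format]])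
    then have "\<forall>\<^sub>F n in sequentially. \<phi> n x = 1"
      by eventually_elim (use x01 in \<open>auto simp: \<phi>_def field_simps min_def\<close>)
    then have 2: "(\<lambda>n. \<phi> n x) \<longlonglongrightarrow> 1" by (rule tendsto_eventually)
    show "(\<lambda>n. f x * h n x) \<longlonglongrightarrow> f x * s x"
      using tendsto_mult[OF tendsto_const[of "f x"] tendsto_mult[OF 2 1]] by (simp add: h_def)
  qed
  then have "(\<lambda>n. \<integral>x. f x * h n x \<partial>unit_measure) \<longlonglongrightarrow> (\<integral>x. f x * s x \<partial>unit_measure)"
  proof (rule integral_dominated_convergence[rotated 3])
    show "integrable unit_measure (\<lambda>x. cmod (f x))" using f by simp
    show "AE x in unit_measure. cmod (f x * h n x) \<le> cmod (f x)" for n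
      by (rule AE_I2) (use hb in \<open>auto simp: norm_mult mult_left_le\<close>)
  qed measurable
  moreover have "(\<integral>x. f x * h n x \<partial>unit_measure) = 0" for n
    by (rule orthogonal_continuous[OF f hc]) (simp add: h_def \<phi>_def)
  ultimately have "(\<integral>x. f x * s x \<partial>unit_measure) = 0" by (simp add: LIMSEQ_const_iff)
  moreover have "f x * s x = of_real (cmod (f x))" for x
  proof -
    have "f x * s x = f x * cnj (f x) / of_real (cmod (f x))" by (simp add: s_def sgn_eq)
    also have "\<dots> = of_real (cmod (f x))"
      unfolding complex_norm_square [symmetric] by (simp add: power2_eq_square)
    finally show ?thesis .
  qed
  ultimately have "(\<integral>x. cmod (f x) \<partial>unit_measure) = 0"
    by (metis (mono_tags, lifting) Bochner_Integration.integral_cong integral_complex_of_real of_real_eq_0_iff)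
  then have "AE x in unit_measure. cmod (f x) = 0"
    by (subst (asm) integral_nonneg_eq_0_iff_AE) (use f in auto)
  then show ?thesis by simp
qed

text \<open>Enumerating the integers by \<open>int_decode\<close> makes theorems on series over the
  naturals, such as termwise integration, available for absolutely convergent sums over the
  integers.\<close>

lemma infsum_int_decode:
  fixes F :: "int \<Rightarrow> complex"
  assumes "(\<lambda>k. cmod (F k)) summable_on UNIV"
  shows "(\<lambda>n. F (int_decode n)) sums (\<Sum>\<^sub>\<infinity>k. F k)" "summable (\<lambda>n. cmod (F (int_decode n)))"
proof -
  have "F summable_on UNIV" by (rule abs_summable_summable) (use assms in simp)
  then have "(F has_sum (\<Sum>\<^sub>\<infinity>k. F k)) UNIV" by (rule has_sum_infsum)
  then have "((\<lambda>n. F (int_decode n)) has_sum (\<Sum>\<^sub>\<infinity>k. F k)) UNIV"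
    by (subst has_sum_reindex_bij_betw[OF bij_int_decode])
  then show "(\<lambda>n. F (int_decode n)) sums (\<Sum>\<^sub>\<infinity>k. F k)" by (rule has_sum_imp_sums)
  have "(\<lambda>n. cmod (F (int_decode n))) summable_on UNIV"
    using assms by (subst summable_on_reindex_bij_betw[OF bij_int_decode])
  then show "summable (\<lambda>n. cmod (F (int_decode n)))" by (rule summable_on_imp_summable)
qed

lemma summable_on_mult_bounded:
  fixes a b :: "'i \<Rightarrow> complex"
  assumes "(\<lambda>k. cmod (a k)) summable_on A" "\<And>k. k \<in> A \<Longrightarrow> cmod (b k) \<le> B"
  shows "(\<lambda>k. cmod (a k * b k)) summable_on A" "(\<lambda>k. a k * b k) summable_on A"
proof -
  show 1: "(\<lambda>k. cmod (a k * b k)) summable_on A"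
  proof (rule summable_on_comparison_test[where f = "\<lambda>k. cmod (a k) * B"])
    show "(\<lambda>k. cmod (a k) * B) summable_on A" by (rule summable_on_cmult_left[OF assms(1)])
  qed (auto simp: norm_mult intro!: mult_left_mono assms(2))
  show "(\<lambda>k. a k * b k) summable_on A"
    by (rule abs_summable_summable) (use 1 in simp)
qed

text \<open>Termwise integration: the uniform bound \<open>B\<close> turns l^1 summability of
  \<open>a\<close> into summability of the integrals of the absolute values. Every later exchange of
  a Fourier series with an integral goes through this fact.\<close>

lemma integral_infsum_bounded:
  fixes a :: "int \<Rightarrow> complex" and h :: "int \<Rightarrow> real \<Rightarrow> complex"
  assumes a: "(\<lambda>k. cmod (a k)) summable_on UNIV"
    and hm: "\<And>k. h k \<in> borel_measurable unit_measure"
    and hb: "\<And>k x. cmod (h k x) \<le> B"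
  shows "(\<integral>x. (\<Sum>\<^sub>\<infinity>k. a k * h k x) \<partial>unit_measure) = (\<Sum>\<^sub>\<infinity>k. a k * (\<integral>x. h k x \<partial>unit_measure))"
    and "(\<lambda>x. \<Sum>\<^sub>\<infinity>k. a k * h k x) \<in> borel_measurable unit_measure"
proof -
  note [measurable] = hm
  let ?e = "int_decode"
  have s: "(\<lambda>k. cmod (a k * h k x)) summable_on UNIV" for x
    by (rule summable_on_mult_bounded[OF a]) (rule hb)
  have eq: "(\<Sum>\<^sub>\<infinity>k. a k * h k x) = (\<Sum>n. a (?e n) * h (?e n) x)" for x
    using infsum_int_decode(1)[OF s] by (simp add: sums_iff)
  show "(\<lambda>x. \<Sum>\<^sub>\<infinity>k. a k * h k x) \<in> borel_measurable unit_measure"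
    unfolding eq by measurable
  have hi: "integrable unit_measure (h k)" for k
    by (rule unit_measure.integrable_const_bound[of _ B]) (use hb in auto)
  have ib: "(\<integral>x. cmod (h k x) \<partial>unit_measure) \<le> B" for k
  proof -
    have "(\<integral>x. cmod (h k x) \<partial>unit_measure) \<le> (\<integral>x. B \<partial>unit_measure)"
      by (rule integral_mono) (use hi hb in auto)
    then show ?thesis by simp
  qed
  have ib': "cmod (\<integral>x. h k x \<partial>unit_measure) \<le> B" for k
    using ib[of k] integral_norm_bound[of unit_measure "h k"] by linarith
  have sa: "summable (\<lambda>n. cmod (a (?e n)))" by (rule infsum_int_decode(2)[OF a])
  have "(\<integral>x. (\<Sum>n. a (?e n) * h (?e n) x) \<partial>unit_measure) = (\<Sum>n. \<integral>x. a (?e n) * h (?e n) x \<partial>unit_measure)"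
  proof (rule integral_suminf)
    show "integrable unit_measure (\<lambda>x. a (?e n) * h (?e n) x)" for n using hi by simp
    show "AE x in unit_measure. summable (\<lambda>n. cmod (a (?e n) * h (?e n) x))"
      using infsum_int_decode(2)[OF s] by simp
    show "summable (\<lambda>n. \<integral>x. cmod (a (?e n) * h (?e n) x) \<partial>unit_measure)"
      by (rule summable_comparison_test'[OF summable_mult2[OF sa, of B], of 0])
        (auto simp: norm_mult abs_mult intro!: mult_left_mono ib)
  qed
  also have "\<dots> = (\<Sum>n. a (?e n) * (\<integral>x. h (?e n) x \<partial>unit_measure))" by simp
  also have "\<dots> = (\<Sum>\<^sub>\<infinity>k. a k * (\<integral>x. h k x \<partial>unit_measure))"
    using infsum_int_decode(1)[OF summable_on_mult_bounded(1)[OF a, of "\<lambda>k. \<integral>x. h k x \<partial>unit_measure" B]] ib'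
    by (simp add: sums_iff)
  finally show "(\<integral>x. (\<Sum>\<^sub>\<infinity>k. a k * h k x) \<partial>unit_measure) = (\<Sum>\<^sub>\<infinity>k. a k * (\<integral>x. h k x \<partial>unit_measure))"
    unfolding eq .
qed

section \<open>Functions with absolutely summable Fourier coefficients: products and
  Parseval\<close>

definition fourier_series :: "(int \<Rightarrow> complex) \<Rightarrow> real \<Rightarrow> complex" where
  "fourier_series a x = (\<Sum>\<^sub>\<infinity>k. a k * fourier_mode k x)"

text \<open>Ties a pointwise function to the sequence that represents it almost everywhere. Absolute
  summability makes the series a bounded function, so that products, differences and L^2 norms turn
  into operations on sequences.\<close>

definition abs_fourier :: "(real \<Rightarrow> complex) \<Rightarrow> (int \<Rightarrow> complex) \<Rightarrow> bool" where
  "abs_fourier f a \<longleftrightarrow> f \<in> borel_measurable unit_measure \<and> (\<lambda>k. cmod (a k)) summable_on UNIV \<and>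
     (AE x in unit_measure. f x = fourier_series a x)"

lemma fourier_series_summable:
  assumes "(\<lambda>k. cmod (a k)) summable_on UNIV"
  shows "(\<lambda>k. a k * fourier_mode k x) summable_on UNIV"
  by (rule summable_on_mult_bounded[OF assms, where B = 1]) simp

lemma fourier_series_mult_right:
  "fourier_series a x * z = (\<Sum>\<^sub>\<infinity>k. a k * (fourier_mode k x * z))"
  by (simp add: fourier_series_def mult.assoc flip: infsum_cmult_left')

lemma norm_fourier_series_le:
  assumes "(\<lambda>k. cmod (a k)) summable_on UNIV"
  shows "cmod (fourier_series a x) \<le> (\<Sum>\<^sub>\<infinity>k. cmod (a k))"
  unfolding fourier_series_def
  using norm_infsum_bound[of "\<lambda>k. a k * fourier_mode k x" UNIV] assms by (simp add: norm_mult)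

lemma borel_measurable_fourier_series:
  assumes "(\<lambda>k. cmod (a k)) summable_on UNIV"
  shows "fourier_series a \<in> borel_measurable unit_measure"
  unfolding fourier_series_def [abs_def]
  by (rule integral_infsum_bounded(2)[OF assms, where B = 1]) auto

lemma fourier_cong_AE:
  assumes "AE x in unit_measure. f x = g x"
    and "f \<in> borel_measurable unit_measure" "g \<in> borel_measurable unit_measure"
  shows "fourier f k = fourier g k"
  unfolding fourier_unit
proof (rule integral_cong_AE)
  show "AE x in unit_measure. f x * fourier_mode (- k) x = g x * fourier_mode (- k) x"
    using assms(1) by eventually_elim simp
qed (use assms in \<open>auto intro!: borel_measurable_times\<close>)

lemma fourier_fourier_series:
  assumes "(\<lambda>k. cmod (a k)) summable_on UNIV"
  shows "fourier (fourier_series a) k = a k"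
proof -
  have "fourier (fourier_series a) k = (\<integral>x. (\<Sum>\<^sub>\<infinity>l. a l * fourier_mode (l - k) x) \<partial>unit_measure)"
    using fourier_mode_add[of _ "-k"] by (simp add: fourier_unit fourier_series_mult_right)
  also have "\<dots> = (\<Sum>\<^sub>\<infinity>l. a l * (\<integral>x. fourier_mode (l - k) x \<partial>unit_measure))"
    by (rule integral_infsum_bounded(1)[OF assms, where B = 1]) auto
  also have "\<dots> = (\<Sum>\<^sub>\<infinity>l\<in>{k}. a l)"
    by (rule infsum_cong_neutral) (auto simp: integral_fourier_mode)
  finally show ?thesis by simp
qed

lemma abs_fourier_coeff:
  assumes "abs_fourier f a"
  shows "fourier f k = a k"
  using assms fourier_cong_AE[of f "fourier_series a" k] fourier_fourier_series[of a k]
    borel_measurable_fourier_series[of a] by (auto simp: abs_fourier_def)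

definition conv :: "(int \<Rightarrow> complex) \<Rightarrow> (int \<Rightarrow> complex) \<Rightarrow> int \<Rightarrow> complex" where
  "conv a b k = (\<Sum>\<^sub>\<infinity>l. a l * b (k - l))"

text \<open>Only the series of \<open>f\<close> is expanded. The series of \<open>g\<close> stays a
  bounded function, and multiplying it by the mode l shifts its coefficient from k to k - l; so one
  interchange of sum and integral suffices and no double series arises.\<close>

lemma abs_fourier_mult:
  assumes f: "abs_fourier f a" and g: "abs_fourier g b"
  shows "fourier (\<lambda>x. f x * g x) k = conv a b k"
proof -
  have a: "(\<lambda>k. cmod (a k)) summable_on UNIV" and b: "(\<lambda>k. cmod (b k)) summable_on UNIV"
    and [measurable]: "f \<in> borel_measurable unit_measure" "g \<in> borel_measurable unit_measure"
    using f g by (auto simp: abs_fourier_def)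
  note [measurable] = borel_measurable_fourier_series[OF a] borel_measurable_fourier_series[OF b]
  have "AE x in unit_measure. f x * g x = fourier_series a x * fourier_series b x"
    using f g unfolding abs_fourier_def by auto
  then have "fourier (\<lambda>x. f x * g x) k = fourier (\<lambda>x. fourier_series a x * fourier_series b x) k"
    by (rule fourier_cong_AE) measurable
  also have "\<dots> = (\<integral>x. (\<Sum>\<^sub>\<infinity>l. a l * (fourier_series b x * fourier_mode (- (k - l)) x)) \<partial>unit_measure)"
    unfolding fourier_unit
  proof (rule Bochner_Integration.integral_cong[OF refl])
    fix x
    have "fourier_series a x * (fourier_series b x * fourier_mode (- k) x) =
      (\<Sum>\<^sub>\<infinity>l. a l * (fourier_mode l x * (fourier_series b x * fourier_mode (- k) x)))"
      by (rule fourier_series_mult_right)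
    also have "\<dots> = (\<Sum>\<^sub>\<infinity>l. a l * (fourier_series b x * fourier_mode (- (k - l)) x))"
      using fourier_mode_add[of _ "-k"] by (simp add: mult_ac)
    finally show "fourier_series a x * fourier_series b x * fourier_mode (- k) x =
      (\<Sum>\<^sub>\<infinity>l. a l * (fourier_series b x * fourier_mode (- (k - l)) x))"
      by (simp add: mult.assoc)
  qed
  also have "\<dots> = (\<Sum>\<^sub>\<infinity>l. a l * (\<integral>x. fourier_series b x * fourier_mode (- (k - l)) x \<partial>unit_measure))"
    by (rule integral_infsum_bounded(1)[OF a, where B = "\<Sum>\<^sub>\<infinity>k. cmod (b k)"])
      (auto simp: norm_mult norm_fourier_series_le[OF b] intro!: borel_measurable_times)
  also have "\<dots> = conv a b k"
    using fourier_fourier_series[OF b] by (simp only: conv_def fourier_unit)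
  finally show ?thesis .
qed

lemma abs_fourier_cnj:
  assumes "abs_fourier f a"
  shows "abs_fourier (\<lambda>x. cnj (f x)) (\<lambda>k. cnj (a (- k)))"
proof -
  have a: "(\<lambda>k. cmod (a k)) summable_on UNIV" and m [measurable]: "f \<in> borel_measurable unit_measure"
    and e: "AE x in unit_measure. f x = fourier_series a x"
    using assms by (auto simp: abs_fourier_def)
  have bij: "bij (uminus :: int \<Rightarrow> int)" by (rule bij_uminus)
  have "(\<lambda>k. cmod (cnj (a (- k)))) summable_on UNIV"
    using a summable_on_reindex_bij_betw[OF bij, of "\<lambda>k. cmod (a k)"] by simp
  moreover have "cnj (fourier_series a x) = fourier_series (\<lambda>k. cnj (a (- k))) x" for x
  proof -
    have "cnj (fourier_series a x) = (\<Sum>\<^sub>\<infinity>k. cnj (a k * fourier_mode k x))"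
      by (simp only: fourier_series_def infsum_cnj)
    also have "\<dots> = (\<Sum>\<^sub>\<infinity>k. cnj (a (- k) * fourier_mode (- k) x))"
      by (rule infsum_reindex_bij_betw[OF bij, symmetric])
    finally show ?thesis by (simp only: fourier_series_def complex_cnj_mult cnj_fourier_mode minus_minus)
  qed
  moreover have "(\<lambda>x. cnj (f x)) \<in> borel_measurable unit_measure"
    by (rule measurable_compose[OF m]) (intro borel_measurable_continuous_onI continuous_intros)
  ultimately show ?thesis using e unfolding abs_fourier_def by auto
qed

lemma abs_fourier_diff:
  assumes f: "abs_fourier f a" and g: "abs_fourier g b"
  shows "abs_fourier (\<lambda>x. f x - g x) (\<lambda>k. a k - b k)"
proof -
  have a: "(\<lambda>k. cmod (a k)) summable_on UNIV" and b: "(\<lambda>k. cmod (b k)) summable_on UNIV"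
    and [measurable]: "f \<in> borel_measurable unit_measure" "g \<in> borel_measurable unit_measure"
    using f g by (auto simp: abs_fourier_def)
  have "(\<lambda>k. cmod (a k - b k)) summable_on UNIV"
    by (rule summable_on_comparison_test[OF summable_on_add[OF a b]]) (auto intro: norm_triangle_ineq4)
  moreover have "fourier_series (\<lambda>k. a k - b k) x = fourier_series a x - fourier_series b x" for x
    unfolding fourier_series_def left_diff_distrib
    using infsum_add[OF fourier_series_summable[OF a] fourier_series_summable[OF b, THEN summable_on_uminus[THEN iffD2]]]
    by (simp add: infsum_uminus)
  ultimately show ?thesis using f g unfolding abs_fourier_def by auto
qed

lemma abs_fourier_trig_space:
  assumes "f = (\<lambda>x. \<Sum>k\<in>K. c k * fourier_mode k x)" "finite K"
  shows "abs_fourier f (\<lambda>k. if k \<in> K then c k else 0)"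
proof -
  have "fourier_series (\<lambda>k. if k \<in> K then c k else 0) x = (\<Sum>\<^sub>\<infinity>k\<in>K. c k * fourier_mode k x)" for x
    unfolding fourier_series_def by (rule infsum_cong_neutral) auto
  moreover have "(\<lambda>k. cmod (if k \<in> K then c k else 0)) summable_on UNIV \<longleftrightarrow> (\<lambda>k. cmod (c k)) summable_on K"
    by (rule summable_on_cong_neutral) auto
  ultimately show ?thesis
    unfolding abs_fourier_def using assms by auto
qed

text \<open>Parseval: |f|^2 is the product of \<open>f\<close> and its conjugate, and its integral
  is the coefficient of that product at frequency 0.\<close>

lemma abs_fourier_L2_norm:
  assumes f: "abs_fourier f a"
  shows "(\<lambda>k. (cmod (a k))\<^sup>2) summable_on UNIV" "(L2_norm f)\<^sup>2 = (\<Sum>\<^sub>\<infinity>k. (cmod (a k))\<^sup>2)"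
proof -
  have a: "(\<lambda>k. cmod (a k)) summable_on UNIV" using f by (simp add: abs_fourier_def)
  have "cmod (a k) \<le> (\<Sum>\<^sub>\<infinity>k. cmod (a k))" for k
    using finite_sum_le_infsum[OF a, of "{k}"] by simp
  from summable_on_mult_bounded(1)[OF a this] show s: "(\<lambda>k. (cmod (a k))\<^sup>2) summable_on UNIV"
    by (simp add: norm_mult power2_eq_square)
  have "complex_of_real (\<integral>x. (cmod (f x))\<^sup>2 \<partial>unit_measure) = fourier (\<lambda>x. f x * cnj (f x)) 0"
    unfolding fourier_unit complex_norm_square [symmetric]
    by (simp flip: integral_complex_of_real of_real_power)
  also have "\<dots> = (\<Sum>\<^sub>\<infinity>l. complex_of_real ((cmod (a l))\<^sup>2))"
    unfolding abs_fourier_mult[OF f abs_fourier_cnj[OF f]] conv_def complex_norm_square by simp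
  also have "\<dots> = complex_of_real (\<Sum>\<^sub>\<infinity>k. (cmod (a k))\<^sup>2)"
    by (rule infsumI has_sum_of_real has_sum_infsum s)+
  finally have "(\<integral>x. (cmod (f x))\<^sup>2 \<partial>unit_measure) = (\<Sum>\<^sub>\<infinity>k. (cmod (a k))\<^sup>2)"
    by (simp only: of_real_eq_iff)
  moreover have "0 \<le> (\<integral>x. (cmod (f x))\<^sup>2 \<partial>unit_measure)" by simp
  ultimately show "(L2_norm f)\<^sup>2 = (\<Sum>\<^sub>\<infinity>k. (cmod (a k))\<^sup>2)"
    unfolding L2_norm_def set_integral_unit by simp
qed

section \<open>Sobolev functions: absolute summability and bounds uniform in time\<close>

lemma periodic_L2_unit:
  assumes "periodic_L2 f"
  shows "f \<in> borel_measurable unit_measure" "integrable unit_measure f"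
    "integrable unit_measure (\<lambda>x. (cmod (f x))\<^sup>2)"
proof -
  show m: "f \<in> borel_measurable unit_measure"
    using assms unfolding periodic_L2_def by (auto intro: measurable_restrict_space1)
  show i: "integrable unit_measure (\<lambda>x. (cmod (f x))\<^sup>2)"
    using assms unfolding periodic_L2_def set_integrable_unit by simp
  show "integrable unit_measure f"
  proof (rule Bochner_Integration.integrable_bound)
    show "integrable unit_measure (\<lambda>x. 1 + (cmod (f x))\<^sup>2)" using i by simp
    show "AE x in unit_measure. cmod (f x) \<le> norm (1 + (cmod (f x))\<^sup>2)"
    proof (rule AE_I2)
      fix x
      have "0 \<le> (cmod (f x) - 1)\<^sup>2" by simp
      then have "2 * cmod (f x) \<le> 1 + (cmod (f x))\<^sup>2" by (simp add: power2_diff)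
      then have "cmod (f x) \<le> 1 + (cmod (f x))\<^sup>2"
        using norm_ge_zero[of "f x"] by linarith
      then show "cmod (f x) \<le> norm (1 + (cmod (f x))\<^sup>2)" by simp
    qed
  qed fact
qed

lemma fourier_diff:
  assumes "periodic_L2 f" "periodic_L2 g"
  shows "fourier (\<lambda>x. f x - g x) k = fourier f k - fourier g k"
proof -
  have "integrable unit_measure (\<lambda>x. f x * fourier_mode (-k) x)"
    "integrable unit_measure (\<lambda>x. g x * fourier_mode (-k) x)"
    by (rule integrable_unit_mult_bounded[where B = 1]; use periodic_L2_unit assms in auto)+
  then show ?thesis unfolding fourier_unit by (simp add: left_diff_distrib)
qed

lemma summable_inverse_squares_int: "(\<lambda>k::int. 1 / (1 + (real_of_int k)\<^sup>2)) summable_on UNIV"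
proof -
  have n: "(\<lambda>n::nat. 1 / (1 + (real n)\<^sup>2)) summable_on UNIV"
  proof (rule summable_nonneg_imp_summable_on)
    have "summable (\<lambda>n. 1 / (real (Suc n))\<^sup>2)"
      using inverse_squares_sums by (auto simp: sums_iff)
    then have "summable (\<lambda>n. 1 / (real n)\<^sup>2)" by (subst (asm) summable_Suc_iff)
    then show "summable (\<lambda>n. 1 / (1 + (real n)\<^sup>2))"
      by (rule summable_comparison_test'[where N = 1])
        (auto intro!: divide_left_mono mult_pos_pos add_pos_nonneg)
  qed simp
  let ?f = "\<lambda>k::int. 1 / (1 + (real_of_int k)\<^sup>2)"
  have "?f summable_on range int"
    using n by (subst summable_on_reindex) (auto simp: o_def)
  moreover have "?f summable_on range (\<lambda>n. - int n)"
    using n by (subst summable_on_reindex) (auto simp: o_def inj_on_def)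
  ultimately have "?f summable_on (range int \<union> range (\<lambda>n. - int n))"
    by (rule summable_on_union)
  also have "range int \<union> range (\<lambda>n. - int n) = UNIV"
    by (auto simp: image_iff) (metis int_cases2)
  finally show ?thesis .
qed

text \<open>AM-GM, used with w = 1 + k^2 in place of Cauchy-Schwarz: l^1 norms are then bounded by a
  weighted l^2 energy plus a fixed constant, without square roots.\<close>

lemma two_mult_le:
  fixes w c :: real
  assumes "w > 0"
  shows "2 * c \<le> w * c\<^sup>2 + 1 / w"
proof -
  have "0 \<le> (w * c - 1)\<^sup>2 / w" using assms by simp
  also have "\<dots> = w * c\<^sup>2 + 1 / w - 2 * c"
    using assms by (simp add: power2_eq_square field_simps)
  finally show ?thesis by simp
qed

text \<open>Because 1 / (1 + k^2) is summable, a finite H^s norm with s >= 1 forces a finite l^1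
  norm of the coefficients; this is the embedding that \<mu> >= 1 provides.\<close>

lemma infsum_norm_le:
  fixes a :: "int \<Rightarrow> complex"
  assumes s: "s \<ge> 1" and sm: "(\<lambda>k::int. (1 + (of_int k)\<^sup>2) powr s * (cmod (a k))\<^sup>2) summable_on UNIV"
  shows "(\<lambda>k. cmod (a k)) summable_on UNIV"
    "(\<Sum>\<^sub>\<infinity>k. cmod (a k)) \<le> (\<Sum>\<^sub>\<infinity>k::int. (1 + (of_int k)\<^sup>2) powr s * (cmod (a k))\<^sup>2)
      + (\<Sum>\<^sub>\<infinity>k::int. 1 / (1 + (real_of_int k)\<^sup>2))"
proof -
  have le: "cmod (a k) \<le> (1 + (of_int k)\<^sup>2) powr s * (cmod (a k))\<^sup>2 + 1 / (1 + (real_of_int k)\<^sup>2)" for k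
  proof -
    let ?w = "1 + (real_of_int k)\<^sup>2" and ?c = "cmod (a k)"
    have w: "?w \<ge> 1" by simp
    have "?w powr 1 \<le> ?w powr s" by (rule powr_mono) (use s w in auto)
    then have "?w * ?c\<^sup>2 \<le> ?w powr s * ?c\<^sup>2" using w by (intro mult_right_mono) auto
    moreover have "2 * ?c \<le> ?w * ?c\<^sup>2 + 1 / ?w"
      by (intro two_mult_le add_pos_nonneg) auto
    moreover have "0 \<le> ?c" by simp
    ultimately show "?c \<le> ?w powr s * ?c\<^sup>2 + 1 / ?w" by linarith
  qed
  note add = summable_on_add[OF sm summable_inverse_squares_int]
  show s1: "(\<lambda>k. cmod (a k)) summable_on UNIV"
    by (rule summable_on_comparison_test[OF add]) (auto intro: le)
  show "(\<Sum>\<^sub>\<infinity>k. cmod (a k)) \<le> (\<Sum>\<^sub>\<infinity>k::int. (1 + (of_int k)\<^sup>2) powr s * (cmod (a k))\<^sup>2)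
      + (\<Sum>\<^sub>\<infinity>k::int. 1 / (1 + (real_of_int k)\<^sup>2))"
    unfolding infsum_add[OF sm summable_inverse_squares_int, symmetric]
    by (rule infsum_mono[OF s1 add]) (rule le)
qed

text \<open>The difference between \<open>f\<close> and its own Fourier series is integrable with
  all coefficients 0, hence vanishes almost everywhere by completeness.\<close>

lemma sobolev_abs_fourier:
  assumes s: "s \<ge> 1" and f: "f \<in> sobolev s"
  shows "abs_fourier f (fourier f)"
proof -
  have f2: "periodic_L2 f"
    and sm: "(\<lambda>k::int. (1 + (of_int k)\<^sup>2) powr s * (cmod (fourier f k))\<^sup>2) summable_on UNIV"
    using f by (auto simp: sobolev_def)
  note a = infsum_norm_le(1)[OF s sm]
  define g where "g x = f x - fourier_series (fourier f) x" for x
  note fm = periodic_L2_unit[OF f2] and gm = borel_measurable_fourier_series[OF a]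
  have si: "integrable unit_measure (fourier_series (fourier f))"
    by (rule unit_measure.integrable_const_bound[OF _ gm])
      (use norm_fourier_series_le[OF a] in auto)
  have "integrable unit_measure g" unfolding g_def [abs_def] using fm si by simp
  moreover have "fourier g k = 0" for k
  proof -
    have "integrable unit_measure (\<lambda>x. f x * fourier_mode (-k) x)"
      "integrable unit_measure (\<lambda>x. fourier_series (fourier f) x * fourier_mode (-k) x)"
      by (rule integrable_unit_mult_bounded[where B = 1]; use fm si in auto)+
    then have "fourier g k = fourier f k - fourier (fourier_series (fourier f)) k"
      unfolding g_def fourier_unit by (simp add: left_diff_distrib)
    then show ?thesis by (simp add: fourier_fourier_series[OF a])
  qed
  ultimately have "AE x in unit_measure. g x = 0" by (rule fourier_zero_imp_AE_zero)
  then show ?thesis using fm a unfolding abs_fourier_def g_def by simp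
qed

text \<open>Compactness of [0,T] in place of continuity of the norm: near each t the squared norm is
  at most twice its value at t plus 2, and finitely many such neighbourhoods cover the
  interval.\<close>

lemma sobolev_norm_bounded:
  assumes f: "continuous_in_sobolev T s f"
  shows "\<exists>M\<ge>0. \<forall>t\<in>{0..T}. (\<Sum>\<^sub>\<infinity>k::int. (1 + (of_int k)\<^sup>2) powr s * (cmod (fourier (f t) k))\<^sup>2) \<le> M"
proof -
  define w where "w k = (1 + (real_of_int k)\<^sup>2) powr s" for k
  define S where "S t = (\<Sum>\<^sub>\<infinity>k. w k * (cmod (fourier (f t) k))\<^sup>2)" for t
  have w: "w k \<ge> 0" for k by (simp add: w_def)
  have sob: "f t \<in> sobolev s" if "t \<in> {0..T}" for t
    using f that by (simp add: continuous_in_sobolev_def)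
  have sm: "(\<lambda>k. w k * (cmod (fourier (f t) k))\<^sup>2) summable_on UNIV" if "t \<in> {0..T}" for t
    using sob[OF that] by (simp add: sobolev_def w_def)
  have S: "S t \<ge> 0" for t unfolding S_def by (rule infsum_nonneg) (simp add: w)
  have loc: "\<exists>U. open U \<and> t \<in> U \<and> (\<forall>r\<in>U \<inter> {0..T}. S r \<le> 2 * S t + 2)" if t: "t \<in> {0..T}" for t
  proof -
    define d where "d r = (\<Sum>\<^sub>\<infinity>k. w k * (cmod (fourier (\<lambda>x. f r x - f t x) k))\<^sup>2)" for r
    have diff: "fourier (\<lambda>x. f r x - f t x) k = fourier (f r) k - fourier (f t) k" if "r \<in> {0..T}" for r k
      by (rule fourier_diff) (use sob[OF that] sob[OF t] in \<open>auto simp: sobolev_def\<close>)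
    have sq: "(cmod (x - y))\<^sup>2 \<le> 2 * (cmod x)\<^sup>2 + 2 * (cmod y)\<^sup>2" for x y :: complex
    proof -
      have "(cmod (x - y))\<^sup>2 \<le> (cmod x + cmod y)\<^sup>2" by (intro power_mono norm_triangle_ineq4) simp
      also have "\<dots> \<le> 2 * (cmod x)\<^sup>2 + 2 * (cmod y)\<^sup>2"
        using sum_squares_bound[of "cmod x" "cmod y"] by (simp add: power2_sum)
      finally show ?thesis .
    qed
    \<comment> \<open>\<open>infsum\<close> is 0 for families that are not summable, so smallness of
      \<open>d r\<close> carries information only once summability is known.\<close>
    have dsum: "(\<lambda>k. w k * (cmod (fourier (\<lambda>x. f r x - f t x) k))\<^sup>2) summable_on UNIV" if r: "r \<in> {0..T}" for r
    proof (rule summable_on_comparison_test[OF summable_on_add[OF summable_on_cmult_right[OF sm[OF r], of 2]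
            summable_on_cmult_right[OF sm[OF t], of 2]]])
      fix k
      show "w k * (cmod (fourier (\<lambda>x. f r x - f t x) k))\<^sup>2
        \<le> 2 * (w k * (cmod (fourier (f r) k))\<^sup>2) + 2 * (w k * (cmod (fourier (f t) k))\<^sup>2)"
        using mult_left_mono[OF sq w] by (simp add: diff[OF r] algebra_simps)
    qed (simp add: w)
    have Sr: "S r \<le> 2 * S t + 2 * d r" if r: "r \<in> {0..T}" for r
    proof -
      have "S r \<le> (\<Sum>\<^sub>\<infinity>k. 2 * (w k * (cmod (fourier (f t) k))\<^sup>2) + 2 * (w k * (cmod (fourier (\<lambda>x. f r x - f t x) k))\<^sup>2))"
        unfolding S_def
      proof (rule infsum_mono[OF sm[OF r]])
        show "(\<lambda>k. 2 * (w k * (cmod (fourier (f t) k))\<^sup>2) + 2 * (w k * (cmod (fourier (\<lambda>x. f r x - f t x) k))\<^sup>2)) summable_on UNIV"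
          by (intro summable_on_add summable_on_cmult_right sm[OF t] dsum[OF r])
        fix k
        have "w k * (cmod (fourier (f t) k - (fourier (f t) k - fourier (f r) k)))\<^sup>2
          \<le> w k * (2 * (cmod (fourier (f t) k))\<^sup>2 + 2 * (cmod (fourier (f t) k - fourier (f r) k))\<^sup>2)"
          by (rule mult_left_mono[OF sq w])
        then show "w k * (cmod (fourier (f r) k))\<^sup>2 \<le> 2 * (w k * (cmod (fourier (f t) k))\<^sup>2)
          + 2 * (w k * (cmod (fourier (\<lambda>x. f r x - f t x) k))\<^sup>2)"
          by (simp add: diff[OF r] algebra_simps norm_minus_commute)
      qed
      also have "\<dots> = 2 * S t + 2 * d r"
        unfolding S_def d_def
        by (subst infsum_add) (auto intro!: summable_on_cmult_right sm[OF t] dsum[OF r] simp: infsum_cmult_right')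
      finally show ?thesis .
    qed
    have "((\<lambda>r. sobolev_norm s (\<lambda>x. f r x - f t x)) \<longlongrightarrow> 0) (at t within {0..T})"
      using f t by (simp add: continuous_in_sobolev_def)
    then have "\<forall>\<^sub>F r in at t within {0..T}. sobolev_norm s (\<lambda>x. f r x - f t x) < 1"
      by (rule order_tendstoD) simp
    then obtain U where U: "open U" "t \<in> U"
      "\<And>r. r \<in> U \<Longrightarrow> r \<noteq> t \<Longrightarrow> r \<in> {0..T} \<Longrightarrow> sobolev_norm s (\<lambda>x. f r x - f t x) < 1"
      unfolding eventually_at_topological by blast
    have "S r \<le> 2 * S t + 2" if r: "r \<in> U \<inter> {0..T}" for r
    proof (cases "r = t")
      case True
      then show ?thesis using S[of t] by simp
    next
      case False
      then have "sqrt (d r) < 1"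
        using U(3)[of r] r by (simp add: sobolev_norm_def d_def w_def)
      then have "d r \<le> 1" using real_sqrt_lt_1_iff by auto
      then show ?thesis using Sr[of r] r by auto
    qed
    with U(1,2) show ?thesis by blast
  qed
  then obtain U where U: "\<And>t. t \<in> {0..T} \<Longrightarrow> open (U t) \<and> t \<in> U t \<and> (\<forall>r\<in>U t \<inter> {0..T}. S r \<le> 2 * S t + 2)"
    by metis
  have "open (U t)" if "t \<in> {0..T}" for t using U that by simp
  moreover have "{0..T} \<subseteq> (\<Union>t\<in>{0..T}. U t)" using U by auto
  ultimately obtain C where C: "C \<subseteq> {0..T}" "finite C" "{0..T} \<subseteq> (\<Union>c\<in>C. U c)"
    using compactE_image[OF compact_Icc] by metis
  have "S t \<le> (\<Sum>c\<in>C. 2 * S c + 2)" if t: "t \<in> {0..T}" for t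
  proof -
    obtain c where c: "c \<in> C" "t \<in> U c" using C t by auto
    then have "S t \<le> 2 * S c + 2" using U[of c] C(1) t by auto
    also have "\<dots> \<le> (\<Sum>c\<in>C. 2 * S c + 2)"
      by (rule member_le_sum) (use c C S in \<open>auto intro!: add_nonneg_nonneg\<close>)
    finally show ?thesis .
  qed
  moreover have "0 \<le> (\<Sum>c\<in>C. 2 * S c + 2)" using S by (auto intro!: sum_nonneg add_nonneg_nonneg)
  ultimately show ?thesis unfolding S_def w_def by blast
qed

section \<open>Convolution estimates and a bootstrap inequality\<close>

lemma conv_add_right:
  assumes "(\<lambda>k. cmod (a k)) summable_on UNIV" "\<And>k. cmod (b k) \<le> B" "\<And>k. cmod (c k) \<le> C"
  shows "conv a (\<lambda>k. b k + c k) k = conv a b k + conv a c k"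
  unfolding conv_def distrib_left
  by (rule infsum_add) (rule summable_on_mult_bounded(2)[OF assms(1)], rule assms)+

lemma conv_commute: "conv a b k = conv b a k"
proof -
  have "bij (\<lambda>l. k - l)" by (rule bij_betwI[where g = "\<lambda>l. k - l"]) auto
  from infsum_reindex_bij_betw[OF this, of "\<lambda>l. a l * b (k - l)"]
  show ?thesis unfolding conv_def by (simp add: mult.commute)
qed

lemma conv_diff_right:
  assumes "(\<lambda>k. cmod (a k)) summable_on UNIV" "\<And>k. cmod (b k) \<le> B" "\<And>k. cmod (c k) \<le> C"
  shows "conv a b k - conv a c k = conv a (\<lambda>k. b k - c k) k"
proof -
  have "cmod (b k - c k) \<le> B + C" for k
    using norm_triangle_ineq4[of "b k" "c k"] assms(2,3)[of k] by linarith
  from conv_add_right[where b = "\<lambda>k. b k - c k" and c = c and k = k, OF assms(1) this assms(3)] show ?thesis by simp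
qed

lemma cmod_le_infsum:
  assumes "(\<lambda>k. cmod (a k)) summable_on UNIV"
  shows "cmod (a k) \<le> (\<Sum>\<^sub>\<infinity>k. cmod (a k))"
  using finite_sum_le_infsum[OF assms, of "{k}"] by simp

text \<open>With \<open>a\<close>, \<open>b\<close> the exact and \<open>c\<close>, \<open>d\<close>
  the approximate \<zeta> and u, the undifferenced factors are \<open>a\<close> and
  \<open>d\<close>; \<open>c\<close> occurs in a difference only.\<close>

lemma conv_mult_diff:
  assumes a: "(\<lambda>k. cmod (a k)) summable_on UNIV" and b: "(\<lambda>k. cmod (b k)) summable_on UNIV"
    and c: "(\<lambda>k. cmod (c k)) summable_on UNIV" and d: "(\<lambda>k. cmod (d k)) summable_on UNIV"
  shows "conv a b k - conv c d k = conv a (\<lambda>k. b k - d k) k + conv d (\<lambda>k. a k - c k) k"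
proof -
  have "conv a b k - conv c d k = (conv a b k - conv a d k) + (conv d a k - conv d c k)"
    by (simp add: conv_commute[of d])
  then show ?thesis
    using conv_diff_right[where b = b and c = d and k = k, OF a cmod_le_infsum[OF b] cmod_le_infsum[OF d]]
      conv_diff_right[where b = a and c = c and k = k, OF d cmod_le_infsum[OF a] cmod_le_infsum[OF c]]
    by simp
qed

lemma infsum_sum:
  fixes f :: "'i \<Rightarrow> 'j \<Rightarrow> 'a :: banach"
  assumes "finite K" "\<And>k. k \<in> K \<Longrightarrow> f k summable_on A"
  shows "(\<Sum>\<^sub>\<infinity>l\<in>A. \<Sum>k\<in>K. f k l) = (\<Sum>k\<in>K. \<Sum>\<^sub>\<infinity>l\<in>A. f k l)"
proof -
  have "(\<lambda>l. \<Sum>k\<in>K. f k l) summable_on A \<and>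
    (\<Sum>\<^sub>\<infinity>l\<in>A. \<Sum>k\<in>K. f k l) = (\<Sum>k\<in>K. \<Sum>\<^sub>\<infinity>l\<in>A. f k l)"
    using assms by (induction K) (auto simp: infsum_add intro: summable_on_add)
  then show ?thesis by simp
qed

text \<open>After exchanging the finite sum over k with the sum over l, each inner sum pairs
  \<open>c\<close> with a translate of \<open>A\<close>, and Cauchy-Schwarz bounds it by
  \<open>p * q\<close> whatever l is; summing against the moduli of \<open>B\<close> gives
  \<open>r\<close>. Translates of \<open>A\<close> leave \<open>K\<close>, which is why its l^2 norm
  is taken over all integers, and the bound does not depend on the size of \<open>K\<close>.\<close>

lemma sum_mult_conv_le:
  assumes K: "finite K"
    and p: "p \<ge> 0" "(\<Sum>k\<in>K. (cmod (c k))\<^sup>2) \<le> p\<^sup>2"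
    and A: "(\<lambda>k. (cmod (A k))\<^sup>2) summable_on UNIV" "q \<ge> 0" "(\<Sum>\<^sub>\<infinity>k. (cmod (A k))\<^sup>2) \<le> q\<^sup>2"
    and B: "(\<lambda>k. cmod (B k)) summable_on UNIV" "(\<Sum>\<^sub>\<infinity>k. cmod (B k)) \<le> r"
  shows "cmod (\<Sum>k\<in>K. c k * conv B A k) \<le> p * q * r"
proof -
  have fin: "(\<Sum>k\<in>F. (cmod (A k))\<^sup>2) \<le> q\<^sup>2" if "finite F" for F
    using finite_sum_le_infsum[OF A(1) that] A(3) by simp
  have Aq: "cmod (A k) \<le> q" for k
    using fin[of "{k}"] A(2) by (simp add: power2_le_iff_abs_le)
  have s: "(\<lambda>l. B l * A (k - l)) summable_on UNIV" for k
    by (rule summable_on_mult_bounded(2)[OF B(1) Aq])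
  have "(\<Sum>k\<in>K. c k * conv B A k) = (\<Sum>k\<in>K. \<Sum>\<^sub>\<infinity>l. c k * (B l * A (k - l)))"
    unfolding conv_def by (simp add: infsum_cmult_right')
  also have "\<dots> = (\<Sum>\<^sub>\<infinity>l. \<Sum>k\<in>K. c k * (B l * A (k - l)))"
    by (rule infsum_sum[OF K, symmetric]) (rule summable_on_cmult_right[OF s])
  also have "\<dots> = (\<Sum>\<^sub>\<infinity>l. B l * (\<Sum>k\<in>K. c k * A (k - l)))"
    by (simp add: sum_distrib_left mult_ac)
  finally have eq: "(\<Sum>k\<in>K. c k * conv B A k) = (\<Sum>\<^sub>\<infinity>l. B l * (\<Sum>k\<in>K. c k * A (k - l)))" .
  have bd: "cmod (\<Sum>k\<in>K. c k * A (k - l)) \<le> p * q" for l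
  proof -
    have "cmod (\<Sum>k\<in>K. c k * A (k - l)) \<le> (\<Sum>k\<in>K. \<bar>cmod (c k)\<bar> * \<bar>cmod (A (k - l))\<bar>)"
      by (rule order_trans[OF norm_sum]) (simp add: norm_mult)
    also have "\<dots> \<le> L2_set (\<lambda>k. cmod (c k)) K * L2_set (\<lambda>k. cmod (A (k - l))) K"
      by (rule L2_set_mult_ineq)
    also have "\<dots> \<le> p * q"
    proof (rule mult_mono)
      show "L2_set (\<lambda>k. cmod (c k)) K \<le> p"
        unfolding L2_set_def using p by (simp add: real_le_lsqrt sum_nonneg)
      have "(\<Sum>k\<in>K. (cmod (A (k - l)))\<^sup>2) = (\<Sum>k\<in>(\<lambda>k. k - l) ` K. (cmod (A k))\<^sup>2)"
        by (subst sum.reindex) (auto simp: inj_on_def)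
      also have "\<dots> \<le> q\<^sup>2" by (rule fin) (use K in simp)
      finally show "L2_set (\<lambda>k. cmod (A (k - l))) K \<le> q"
        unfolding L2_set_def using A(2) by (simp add: real_le_lsqrt sum_nonneg)
    qed (use p in auto)
    finally show ?thesis .
  qed
  have "cmod (\<Sum>\<^sub>\<infinity>l. B l * (\<Sum>k\<in>K. c k * A (k - l))) \<le> (\<Sum>\<^sub>\<infinity>l. cmod (B l * (\<Sum>k\<in>K. c k * A (k - l))))"
    by (rule norm_infsum_bound) (use summable_on_mult_bounded(1)[OF B(1) bd] in simp)
  also have "\<dots> \<le> (\<Sum>\<^sub>\<infinity>l. cmod (B l) * (p * q))"
    by (rule infsum_mono[OF summable_on_mult_bounded(1)[OF B(1) bd] summable_on_cmult_left[OF B(1)]])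
      (auto simp: norm_mult intro!: mult_left_mono bd)
  also have "\<dots> \<le> p * q * r"
    using mult_left_mono[OF B(2), of "p * q"] p A(2) by (subst infsum_cmult_left') (simp add: mult_ac)
  finally show ?thesis unfolding eq .
qed

lemma infsum_split:
  fixes f :: "'i \<Rightarrow> real"
  assumes "finite K" "f summable_on (- K)"
  shows "f summable_on UNIV" "(\<Sum>\<^sub>\<infinity>k. f k) = (\<Sum>k\<in>K. f k) + (\<Sum>\<^sub>\<infinity>k\<in>-K. f k)"
proof -
  have U: "UNIV = K \<union> - K" by auto
  show "f summable_on UNIV"
    unfolding U by (rule summable_on_Un_disjoint) (use assms in auto)
  show "(\<Sum>\<^sub>\<infinity>k. f k) = (\<Sum>k\<in>K. f k) + (\<Sum>\<^sub>\<infinity>k\<in>-K. f k)"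
    unfolding U by (subst infsum_Un_disjoint) (use assms in auto)
qed

text \<open>For |k| > N the weight (1 + k^2)^s is at least N^(2s), so the tail of the H^s sum pays
  for the rate.\<close>

lemma infsum_tail_le:
  fixes a :: "int \<Rightarrow> complex"
  assumes s: "s \<ge> 0" and N: "N \<ge> 1"
    and sm: "(\<lambda>k::int. (1 + (of_int k)\<^sup>2) powr s * (cmod (a k))\<^sup>2) summable_on UNIV"
    and M: "(\<Sum>\<^sub>\<infinity>k::int. (1 + (of_int k)\<^sup>2) powr s * (cmod (a k))\<^sup>2) \<le> M"
  shows "(\<lambda>k. (cmod (a k))\<^sup>2) summable_on - {- int N..int N}"
    "(\<Sum>\<^sub>\<infinity>k\<in>- {- int N..int N}. (cmod (a k))\<^sup>2) \<le> M * (real N powr - s)\<^sup>2"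
proof -
  let ?w = "\<lambda>k::int. (1 + (real_of_int k)\<^sup>2) powr s" and ?K = "- {- int N..int N}"
  let ?c = "(real N powr - s)\<^sup>2"
  have le: "(cmod (a k))\<^sup>2 \<le> (?w k * (cmod (a k))\<^sup>2) * ?c" if "k \<in> ?K" for k
  proof -
    have "int N \<le> \<bar>k\<bar>" using that by auto
    then have "real N \<le> \<bar>real_of_int k\<bar>" by linarith
    then have "(real N)\<^sup>2 \<le> (real_of_int k)\<^sup>2" using abs_le_square_iff[of "real N" "real_of_int k"] by simp
    then have "((real N)\<^sup>2) powr s \<le> ?w k" using s by (intro powr_mono2) auto
    moreover have "((real N)\<^sup>2) powr s * ?c = 1"
      using N by (simp add: power2_eq_square powr_mult powr_minus field_simps)
    ultimately have "1 \<le> ?w k * ?c" by (metis mult_right_mono zero_le_power2)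
    from mult_right_mono[OF this, of "(cmod (a k))\<^sup>2"] show ?thesis by (simp add: mult_ac)
  qed
  have smK: "(\<lambda>k. ?w k * (cmod (a k))\<^sup>2) summable_on ?K"
    by (rule summable_on_subset_banach[OF sm]) simp
  note smc = summable_on_cmult_left[OF smK, of ?c]
  show s1: "(\<lambda>k. (cmod (a k))\<^sup>2) summable_on ?K"
    by (rule summable_on_comparison_test[OF smc]) (auto intro: le)
  have "(\<Sum>\<^sub>\<infinity>k\<in>?K. (cmod (a k))\<^sup>2) \<le> (\<Sum>\<^sub>\<infinity>k\<in>?K. (?w k * (cmod (a k))\<^sup>2) * ?c)"
    by (rule infsum_mono[OF s1 smc]) (rule le)
  also have "\<dots> = (\<Sum>\<^sub>\<infinity>k\<in>?K. ?w k * (cmod (a k))\<^sup>2) * ?c" by (rule infsum_cmult_left')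
  also have "\<dots> \<le> (\<Sum>\<^sub>\<infinity>k. ?w k * (cmod (a k))\<^sup>2) * ?c"
    by (intro mult_right_mono infsum_mono2 sm smK) auto
  also have "\<dots> \<le> M * ?c" by (rule mult_right_mono[OF M]) simp
  finally show "(\<Sum>\<^sub>\<infinity>k\<in>?K. (cmod (a k))\<^sup>2) \<le> M * ?c" .
qed

text \<open>Continuity argument: as long as E < 1 the function \<open>G\<close> does not increase,
  which bounds E by \<delta> exp(K T) < 1. At a first time with E >= 1 this bound would still hold,
  a contradiction; so the threshold is never reached and the differential inequality is available
  throughout.\<close>

lemma bootstrap_gronwall:
  fixes E :: "real \<Rightarrow> real"
  assumes cont: "continuous_on {0..T} E" and E0: "E 0 = 0" and K: "K \<ge> 0" and \<delta>: "\<delta> \<ge> 0"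
    and small: "\<delta> * exp (K * T) < 1"
    and deriv: "\<And>t. t \<in> {0..T} \<Longrightarrow> E t < 1 \<Longrightarrow>
      \<exists>D. (E has_real_derivative D) (at t within {0..T}) \<and> D \<le> K * (\<delta> + E t)"
    and t: "t \<in> {0..T}"
  shows "E t \<le> \<delta> * exp (K * T)"
proof -
  define G where "G r = (\<delta> + E r) * exp (- K * r)" for r
  \<comment> \<open>Smallness is required strictly before \<open>s\<close> only, so that the claim
    applies at the first time at which \<open>E\<close> reaches 1.\<close>
  have G: "G s \<le> \<delta>" if s: "s \<in> {0..T}" and lt: "\<And>r. 0 \<le> r \<Longrightarrow> r < s \<Longrightarrow> E r < 1" for s
  proof -
    have "G s \<le> G 0"
    proof (rule DERIV_nonpos_imp_decreasing_open[of 0 s G])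
      show "0 \<le> s" using s by simp
      show "continuous_on {0..s} G" unfolding G_def [abs_def]
        by (intro continuous_intros continuous_on_subset[OF cont]) (use s in simp)
      fix r assume r: "0 < r" "r < s"
      then have rT: "r \<in> {0..T}" "r \<in> interior {0..T}" using s by auto
      have "E r < 1" by (rule lt) (use r in auto)
      from deriv[OF rT(1) this] obtain D
        where D: "(E has_real_derivative D) (at r within {0..T})" "D \<le> K * (\<delta> + E r)"
        by (elim exE conjE)
      have "(E has_real_derivative D) (at r)" using D(1) unfolding at_within_interior[OF rT(2)] .
      then have "(G has_real_derivative (D - K * (\<delta> + E r)) * exp (- K * r)) (at r)"
        unfolding G_def by (auto intro!: derivative_eq_intros simp: algebra_simps)
      moreover have "(D - K * (\<delta> + E r)) * exp (- K * r) \<le> 0"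
        using D(2) by (simp add: mult_nonpos_nonneg)
      ultimately show "\<exists>y. (G has_real_derivative y) (at r) \<and> y \<le> 0" by blast
    qed
    then show ?thesis by (simp add: G_def E0)
  qed
  have bound: "E s \<le> \<delta> * exp (K * T)" if s: "s \<in> {0..T}" and le: "G s \<le> \<delta>" for s
  proof -
    have "\<delta> + E s = G s * exp (K * s)" by (simp add: G_def flip: exp_add)
    also have "\<dots> \<le> \<delta> * exp (K * s)" using le by simp
    also have "\<dots> \<le> \<delta> * exp (K * T)" using s K \<delta> by (simp add: mult_left_mono)
    finally show ?thesis using \<delta> by simp
  qed
  have "E r < 1" if r: "r \<in> {0..T}" for r
  proof (rule ccontr)
    assume "\<not> E r < 1"
    define S where "S = {s \<in> {0..T}. E s \<in> {1..}}"
    have "closed S" unfolding S_def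
      using continuous_closed_preimage[OF cont, of "{1..}"] by (simp add: vimage_def Int_def)
    moreover have "bounded S" by (rule bounded_subset[of "{0..T}"]) (auto simp: S_def)
    ultimately have "compact S" by (simp add: compact_eq_bounded_closed)
    moreover have "r \<in> S" using r \<open>\<not> E r < 1\<close> by (simp add: S_def)
    ultimately obtain s where s: "s \<in> S" "\<And>x. x \<in> S \<Longrightarrow> s \<le> x"
      using compact_attains_inf[of S] by blast
    have "E x < 1" if "0 \<le> x" "x < s" for x
    proof (rule ccontr)
      assume "\<not> E x < 1"
      then have "x \<in> S" using s(1) that by (simp add: S_def)
      from s(2)[OF this] that show False by simp
    qed
    then have "E s \<le> \<delta> * exp (K * T)"
      using s(1) by (intro bound G) (auto simp: S_def)
    then show False using s(1) small by (simp add: S_def)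
  qed
  with t show ?thesis by (intro bound G) auto
qed

section \<open>Energy estimate\<close>

text \<open>Off -N..N the approximation vanishes and the difference is the exact coefficient: its
  tail gives the first summand, and \<open>e\<close> covers the rest.\<close>

lemma infsum_diff_le:
  fixes A a :: "int \<Rightarrow> complex"
  assumes s: "s \<ge> 0" and N: "N \<ge> 1"
    and A: "(\<lambda>k::int. (1 + (of_int k)\<^sup>2) powr s * (cmod (A k))\<^sup>2) summable_on UNIV"
      "(\<Sum>\<^sub>\<infinity>k::int. (1 + (of_int k)\<^sup>2) powr s * (cmod (A k))\<^sup>2) \<le> M"
    and a: "\<forall>k. k \<notin> {- int N..int N} \<longrightarrow> a k = 0"
    and le: "(\<Sum>k\<in>{- int N..int N}. (cmod (A k - a k))\<^sup>2) \<le> e"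
  shows "(\<lambda>k. (cmod (A k - a k))\<^sup>2) summable_on UNIV"
    "(\<Sum>\<^sub>\<infinity>k. (cmod (A k - a k))\<^sup>2) \<le> M * (real N powr - s)\<^sup>2 + e"
proof -
  define K where "K = {- int N..int N}"
  have fin: "finite K" by (simp add: K_def)
  note tail = infsum_tail_le[OF s N A, folded K_def]
  note a = a[folded K_def]
  have 1: "(\<lambda>k. (cmod (A k - a k))\<^sup>2) summable_on - K"
    using tail(1) a summable_on_cong[of "- K" "\<lambda>k. (cmod (A k - a k))\<^sup>2" "\<lambda>k. (cmod (A k))\<^sup>2"] by simp
  have 2: "(\<Sum>\<^sub>\<infinity>k\<in>-K. (cmod (A k - a k))\<^sup>2) = (\<Sum>\<^sub>\<infinity>k\<in>-K. (cmod (A k))\<^sup>2)"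
    by (rule infsum_cong) (use a in simp)
  show "(\<lambda>k. (cmod (A k - a k))\<^sup>2) summable_on UNIV" by (rule infsum_split(1)[OF fin 1])
  show "(\<Sum>\<^sub>\<infinity>k. (cmod (A k - a k))\<^sup>2) \<le> M * (real N powr - s)\<^sup>2 + e"
    using infsum_split(2)[OF fin 1] 2 tail(2) le by (simp add: K_def)
qed

text \<open>\<open>Z\<close>, \<open>U\<close> are the Fourier coefficients of the exact solution and \<open>w\<close> is the symmetrizer:
  \<open>p k = w k * r k\<close> makes the linear coupling cancel in the energy.\<close>

locale dispersive_system =
  fixes Z U :: "real \<Rightarrow> int \<Rightarrow> complex" and m n p r w :: "int \<Rightarrow> real" and T s M w0 m0 n0 :: real
  assumes s: "s \<ge> 1" and T: "T > 0" and w0: "0 < w0" "w0 \<le> 1" and m0: "m0 \<ge> 0" and n0: "n0 \<ge> 0"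
    and w_ge: "\<And>k. w0 * (1 + (of_int k)\<^sup>2) \<le> w k"
    and m_le: "\<And>k. \<bar>m k\<bar> \<le> m0" and n_le: "\<And>k. w k * (n k)\<^sup>2 \<le> n0\<^sup>2"
    and p_eq: "\<And>k. p k = w k * r k"
    and Z_sum: "\<And>t. t \<in> {0..T} \<Longrightarrow> (\<lambda>k::int. (1 + (of_int k)\<^sup>2) powr s * (cmod (Z t k))\<^sup>2) summable_on UNIV"
    and U_sum: "\<And>t. t \<in> {0..T} \<Longrightarrow> (\<lambda>k::int. (1 + (of_int k)\<^sup>2) powr s * (cmod (U t k))\<^sup>2) summable_on UNIV"
    and Z_le: "\<And>t. t \<in> {0..T} \<Longrightarrow> (\<Sum>\<^sub>\<infinity>k::int. (1 + (of_int k)\<^sup>2) powr s * (cmod (Z t k))\<^sup>2) \<le> M"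
    and U_le: "\<And>t. t \<in> {0..T} \<Longrightarrow> (\<Sum>\<^sub>\<infinity>k::int. (1 + (of_int k)\<^sup>2) powr s * (cmod (U t k))\<^sup>2) \<le> M"
    and Z_deriv: "\<And>t k. t \<in> {0..T} \<Longrightarrow> ((\<lambda>\<tau>. Z \<tau> k) has_vector_derivative
        \<i> * of_real (m k) * conv (Z t) (U t) k - \<i> * of_real (p k) * U t k) (at t within {0..T})"
    and U_deriv: "\<And>t k. t \<in> {0..T} \<Longrightarrow> ((\<lambda>\<tau>. U \<tau> k) has_vector_derivative
        \<i> * of_real (n k) * conv (U t) (U t) k - \<i> * of_real (r k) * Z t k) (at t within {0..T})"
begin

text \<open>\<open>S\<close> is the constant of the embedding into l^1, and \<open>L\<close> below
  bounds the l^1 norms of \<open>Z t\<close> and \<open>U t\<close> uniformly in t.\<close>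

definition S where "S = (\<Sum>\<^sub>\<infinity>k::int. 1 / (1 + (real_of_int k)\<^sup>2))"

definition L where "L = M + S"

definition energy :: "int set \<Rightarrow> (real \<Rightarrow> int \<Rightarrow> complex) \<Rightarrow> (real \<Rightarrow> int \<Rightarrow> complex) \<Rightarrow> real \<Rightarrow> real" where
  "energy K z v t = (\<Sum>k\<in>K. (cmod (Z t k - z t k))\<^sup>2 + w k * (cmod (U t k - v t k))\<^sup>2)"

text \<open>The middle factor adds \<open>L\<close> and the bound \<open>L + 1 / w0 + S\<close> for
  the l^1 norm of the approximate u at energy at most 1. The division by \<open>w0\<close> is the
  cost of recovering L^2 norms from the energy. This is the rate for half the derivative of the
  energy; the missing 2 comes from differentiating squares.\<close>

definition rate where "rate = (m0 + n0) * (2 * L + 1 / w0 + S) / w0"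

lemma w_pos: "w k > 0"
  using w_ge[of k] mult_pos_pos[OF w0(1), of "1 + (real_of_int k)\<^sup>2"] by (simp add: add_pos_nonneg)

lemma S_nonneg: "S \<ge> 0"
  unfolding S_def by (rule infsum_nonneg) simp

lemma M_nonneg: "M \<ge> 0"
proof -
  have "0 \<le> (\<Sum>\<^sub>\<infinity>k::int. (1 + (of_int k)\<^sup>2) powr s * (cmod (Z 0 k))\<^sup>2)"
    by (rule infsum_nonneg) simp
  then show ?thesis using Z_le[of 0] T by simp
qed

lemma L_nonneg: "L \<ge> 0"
  using M_nonneg S_nonneg by (simp add: L_def)

lemma rate_nonneg: "rate \<ge> 0"
  unfolding rate_def using m0 n0 L_nonneg S_nonneg w0 by auto

lemma Z_abs: "t \<in> {0..T} \<Longrightarrow> (\<lambda>k. cmod (Z t k)) summable_on UNIV" "t \<in> {0..T} \<Longrightarrow> (\<Sum>\<^sub>\<infinity>k. cmod (Z t k)) \<le> L"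
  using infsum_norm_le[OF s Z_sum, of t] Z_le[of t] by (auto simp: L_def S_def)

lemma U_abs: "t \<in> {0..T} \<Longrightarrow> (\<lambda>k. cmod (U t k)) summable_on UNIV" "t \<in> {0..T} \<Longrightarrow> (\<Sum>\<^sub>\<infinity>k. cmod (U t k)) \<le> L"
  using infsum_norm_le[OF s U_sum, of t] U_le[of t] by (auto simp: L_def S_def)

text \<open>By \<open>w_ge\<close> the energy controls the H^1 norm of the u error at the cost of
  1/w0. The fourth bound, obtained from it by AM-GM, is the l^1 control on which the nonlinear
  estimate rests.\<close>

lemma energy_terms_le:
  assumes "finite K"
  shows "(\<Sum>k\<in>K. (cmod (Z t k - z t k))\<^sup>2) \<le> energy K z v t"
    "(\<Sum>k\<in>K. w k * (cmod (U t k - v t k))\<^sup>2) \<le> energy K z v t"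
    "(\<Sum>k\<in>K. (cmod (U t k - v t k))\<^sup>2) \<le> energy K z v t / w0"
    "(\<Sum>k\<in>K. cmod (U t k - v t k)) \<le> energy K z v t / w0 + S"
    "0 \<le> energy K z v t"
proof -
  note nn = mult_nonneg_nonneg[OF less_imp_le[OF w_pos] zero_le_power2]
  show "(\<Sum>k\<in>K. (cmod (Z t k - z t k))\<^sup>2) \<le> energy K z v t"
    unfolding energy_def by (rule sum_mono) (simp add: nn)
  show 2: "(\<Sum>k\<in>K. w k * (cmod (U t k - v t k))\<^sup>2) \<le> energy K z v t"
    unfolding energy_def by (rule sum_mono) simp
  show "0 \<le> energy K z v t" unfolding energy_def by (intro sum_nonneg add_nonneg_nonneg nn) auto
  define X where "X k = cmod (U t k - v t k)" for k
  have "(\<Sum>k\<in>K. (1 + (real_of_int k)\<^sup>2) * (X k)\<^sup>2) \<le> (\<Sum>k\<in>K. w k * (X k)\<^sup>2 / w0)"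
  proof (rule sum_mono)
    fix k
    have "w0 * (1 + (real_of_int k)\<^sup>2) * (X k)\<^sup>2 \<le> w k * (X k)\<^sup>2" by (intro mult_right_mono w_ge) simp
    then show "(1 + (real_of_int k)\<^sup>2) * (X k)\<^sup>2 \<le> w k * (X k)\<^sup>2 / w0"
      using w0 by (simp add: field_simps)
  qed
  also have "\<dots> \<le> energy K z v t / w0"
    using 2 w0 by (simp add: X_def divide_right_mono flip: sum_divide_distrib)
  finally have H1: "(\<Sum>k\<in>K. (1 + (real_of_int k)\<^sup>2) * (X k)\<^sup>2) \<le> energy K z v t / w0" .
  have "(\<Sum>k\<in>K. (X k)\<^sup>2) \<le> (\<Sum>k\<in>K. (1 + (real_of_int k)\<^sup>2) * (X k)\<^sup>2)"
    by (rule sum_mono) (simp add: distrib_right)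
  with H1 show "(\<Sum>k\<in>K. (cmod (U t k - v t k))\<^sup>2) \<le> energy K z v t / w0"
    by (simp add: X_def)
  have "(\<Sum>k\<in>K. X k) \<le> (\<Sum>k\<in>K. (1 + (real_of_int k)\<^sup>2) * (X k)\<^sup>2 + 1 / (1 + (real_of_int k)\<^sup>2))"
  proof (rule sum_mono)
    fix k
    have "2 * X k \<le> (1 + (real_of_int k)\<^sup>2) * (X k)\<^sup>2 + 1 / (1 + (real_of_int k)\<^sup>2)"
      by (rule two_mult_le) (simp add: add_pos_nonneg)
    moreover have "X k \<ge> 0" by (simp add: X_def)
    ultimately show "X k \<le> (1 + (real_of_int k)\<^sup>2) * (X k)\<^sup>2 + 1 / (1 + (real_of_int k)\<^sup>2)" by linarith
  qed
  also have "\<dots> \<le> energy K z v t / w0 + S"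
    unfolding sum.distrib S_def
    by (intro add_mono H1 finite_sum_le_infsum[OF summable_inverse_squares_int assms]) auto
  finally show "(\<Sum>k\<in>K. cmod (U t k - v t k)) \<le> energy K z v t / w0 + S" by (simp add: X_def)
qed

text \<open>Half the time derivative of the energy, frozen at one time: \<open>z\<close> and
  \<open>v\<close> are arbitrary sequences supported in \<open>K\<close>, and no differentiability
  is involved. The linear terms cancel, and four pairings with a convolution remain, each at most a
  constant times sqrt(E) times the full l^2 error, tail included.\<close>

lemma energy_rate_le:
  fixes z v :: "int \<Rightarrow> complex"
  assumes t: "t \<in> {0..T}" and N: "N \<ge> 1" and K: "K = {- int N..int N}"
    and supp: "\<forall>k. k \<notin> K \<longrightarrow> z k = 0" "\<forall>k. k \<notin> K \<longrightarrow> v k = 0"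
    and E: "E = energy K (\<lambda>_. z) (\<lambda>_. v) t" "E \<le> 1"
  shows "(\<Sum>k\<in>K. (Z t k - z k) \<bullet> ((\<i> * of_real (m k) * conv (Z t) (U t) k - \<i> * of_real (p k) * U t k)
        - (\<i> * of_real (m k) * conv z v k - \<i> * of_real (p k) * v k))
      + w k * ((U t k - v k) \<bullet> ((\<i> * of_real (n k) * conv (U t) (U t) k - \<i> * of_real (r k) * Z t k)
        - (\<i> * of_real (n k) * conv v v k - \<i> * of_real (r k) * z k))))
    \<le> rate * (M * (real N powr - s)\<^sup>2 + E)" (is "?lhs \<le> _")
proof -
  define \<delta> where "\<delta> = M * (real N powr - s)\<^sup>2"
  have fin: "finite K" by (simp add: K)
  have \<delta>: "\<delta> \<ge> 0" using M_nonneg by (simp add: \<delta>_def)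
  \<comment> \<open>\<open>q\<close> bounds the l^2 norms of both errors over all integers: the tail
    contributes \<delta>, and w0 <= 1 lets one bound serve \<zeta> and u alike.\<close>
  define q where "q = sqrt ((\<delta> + E) / w0)"
  note et = energy_terms_le[OF fin, where t = t and z = "\<lambda>_. z" and v = "\<lambda>_. v", folded E(1)]
  have E0: "E \<ge> 0" by (rule et(5))
  have q: "q \<ge> 0" "q\<^sup>2 = (\<delta> + E) / w0" using \<delta> E0 w0 by (auto simp: q_def)
  have Eq: "sqrt E \<le> q" unfolding q_def
  proof (rule real_sqrt_le_mono)
    have "E * w0 \<le> E" using E0 w0 by (simp add: mult_left_le)
    then show "E \<le> (\<delta> + E) / w0" using \<delta> w0 by (simp add: field_simps)
  qed
  have fs: "(\<lambda>k. cmod (a k)) summable_on UNIV" "(\<Sum>\<^sub>\<infinity>k. cmod (a k)) = (\<Sum>k\<in>K. cmod (a k))"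
    if "\<forall>k. k \<notin> K \<longrightarrow> a k = 0" for a :: "int \<Rightarrow> complex"
  proof -
    have "(\<lambda>k. cmod (a k)) summable_on UNIV \<longleftrightarrow> (\<lambda>k. cmod (a k)) summable_on K"
      by (rule summable_on_cong_neutral) (use that in auto)
    then show "(\<lambda>k. cmod (a k)) summable_on UNIV" using fin by simp
    have "(\<Sum>\<^sub>\<infinity>k. cmod (a k)) = (\<Sum>\<^sub>\<infinity>k\<in>K. cmod (a k))"
      by (rule infsum_cong_neutral) (use that in auto)
    then show "(\<Sum>\<^sub>\<infinity>k. cmod (a k)) = (\<Sum>k\<in>K. cmod (a k))" using fin by simp
  qed
  note z = fs[of z, OF supp(1)] and v = fs[of v, OF supp(2)]
  have sq: "(\<lambda>k. (cmod (A k - a k))\<^sup>2) summable_on UNIV" "(\<Sum>\<^sub>\<infinity>k. (cmod (A k - a k))\<^sup>2) \<le> q\<^sup>2"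
    if A: "(\<lambda>k::int. (1 + (of_int k)\<^sup>2) powr s * (cmod (A k))\<^sup>2) summable_on UNIV"
      "(\<Sum>\<^sub>\<infinity>k::int. (1 + (of_int k)\<^sup>2) powr s * (cmod (A k))\<^sup>2) \<le> M"
      and a: "\<forall>k. k \<notin> K \<longrightarrow> a k = 0" and le: "(\<Sum>k\<in>K. (cmod (A k - a k))\<^sup>2) \<le> E / w0"
    for A a :: "int \<Rightarrow> complex"
  proof -
    have "s \<ge> 0" using s by simp
    note diff = infsum_diff_le[OF this N A, of "\<lambda>k. a k", folded K \<delta>_def, OF a le]
    show "(\<lambda>k. (cmod (A k - a k))\<^sup>2) summable_on UNIV" by (rule diff(1))
    have "\<delta> * w0 \<le> \<delta>" using \<delta> w0 by (simp add: mult_left_le)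
    then have "\<delta> \<le> \<delta> / w0" using w0 by (simp add: field_simps)
    then show "(\<Sum>\<^sub>\<infinity>k. (cmod (A k - a k))\<^sup>2) \<le> q\<^sup>2"
      using diff(2) by (simp add: q add_divide_distrib)
  qed
  have "E * w0 \<le> E" using E0 w0 by (simp add: mult_left_le)
  then have "E \<le> E / w0" using w0 by (simp add: field_simps)
  then have "(\<Sum>k\<in>K. (cmod (Z t k - z k))\<^sup>2) \<le> E / w0" using et(1) by simp
  note DZ = sq[OF Z_sum[OF t] Z_le[OF t] supp(1) this] and DU = sq[OF U_sum[OF t] U_le[OF t] supp(2) et(3)]
  \<comment> \<open>Bound for the l^1 norm of \<open>v\<close>: \<open>L\<close> for the exact u,
    and \<open>1 / w0 + S\<close> for the error, where E <= 1 is used.\<close>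
  define V where "V = L + 1 / w0 + S"
  have V: "(\<Sum>\<^sub>\<infinity>k. cmod (v k)) \<le> V"
  proof -
    have "(\<Sum>\<^sub>\<infinity>k. cmod (v k)) \<le> (\<Sum>k\<in>K. cmod (U t k) + cmod (U t k - v k))"
      unfolding v(2)
    proof (rule sum_mono)
      show "cmod (v k) \<le> cmod (U t k) + cmod (U t k - v k)" for k
        using norm_triangle_ineq4[of "U t k" "U t k - v k"] by simp
    qed
    also have "\<dots> \<le> L + (E / w0 + S)"
      unfolding sum.distrib
      by (intro add_mono et(4) order_trans[OF finite_sum_le_infsum[OF U_abs(1)[OF t] fin] U_abs(2)[OF t]]) auto
    also have "E / w0 \<le> 1 / w0" using E(2) w0 by (simp add: divide_right_mono)
    finally show ?thesis by (simp add: V_def)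
  qed
  define c1 where "c1 k = cnj (Z t k - z k) * (\<i> * of_real (m k))" for k
  define c2 where "c2 k = of_real (w k) * cnj (U t k - v k) * (\<i> * of_real (n k))" for k
  have c1: "(\<Sum>k\<in>K. (cmod (c1 k))\<^sup>2) \<le> (m0 * sqrt E)\<^sup>2"
  proof -
    have "(\<Sum>k\<in>K. (cmod (c1 k))\<^sup>2) \<le> (\<Sum>k\<in>K. m0\<^sup>2 * (cmod (Z t k - z k))\<^sup>2)"
    proof (rule sum_mono)
      fix k
      have "(m k)\<^sup>2 \<le> m0\<^sup>2" using m_le[of k] m0 abs_le_square_iff[of "m k" m0] by simp
      from mult_right_mono[OF this, of "(cmod (Z t k - z k))\<^sup>2"]
      show "(cmod (c1 k))\<^sup>2 \<le> m0\<^sup>2 * (cmod (Z t k - z k))\<^sup>2"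
        by (simp add: c1_def norm_mult power_mult_distrib mult.commute del: complex_cnj_diff)
    qed
    also have "\<dots> \<le> m0\<^sup>2 * E" unfolding sum_distrib_left [symmetric] by (intro mult_left_mono et(1)) simp
    finally show ?thesis using E0 by (simp add: power_mult_distrib)
  qed
  have c2: "(\<Sum>k\<in>K. (cmod (c2 k))\<^sup>2) \<le> (n0 * sqrt E)\<^sup>2"
  proof -
    have "(\<Sum>k\<in>K. (cmod (c2 k))\<^sup>2) \<le> (\<Sum>k\<in>K. n0\<^sup>2 * (w k * (cmod (U t k - v k))\<^sup>2))"
    proof (rule sum_mono)
      fix k
      \<comment> \<open>The weight occurs squared: one factor is absorbed by the decay of
        \<open>n k\<close>, the other belongs to the energy.\<close>
      have "(cmod (c2 k))\<^sup>2 = (w k * (n k)\<^sup>2) * (w k * (cmod (U t k - v k))\<^sup>2)"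
        by (simp add: c2_def norm_mult power_mult_distrib power2_eq_square mult_ac del: complex_cnj_diff)
      also have "\<dots> \<le> n0\<^sup>2 * (w k * (cmod (U t k - v k))\<^sup>2)"
        by (intro mult_right_mono n_le) (simp add: less_imp_le[OF w_pos])
      finally show "(cmod (c2 k))\<^sup>2 \<le> n0\<^sup>2 * (w k * (cmod (U t k - v k))\<^sup>2)" .
    qed
    also have "\<dots> \<le> n0\<^sup>2 * E" unfolding sum_distrib_left [symmetric] by (intro mult_left_mono et(2)) simp
    finally show ?thesis using E0 by (simp add: power_mult_distrib)
  qed
  have nonneg: "m0 * sqrt E \<ge> 0" "n0 * sqrt E \<ge> 0" using m0 n0 E0 by auto
  note Zt = Z_abs[OF t] and Ut = U_abs[OF t]
  let ?DU = "\<lambda>k. U t k - v k" and ?DZ = "\<lambda>k. Z t k - z k"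
  have term_eq: "?DZ k \<bullet> ((\<i> * of_real (m k) * conv (Z t) (U t) k - \<i> * of_real (p k) * U t k)
        - (\<i> * of_real (m k) * conv z v k - \<i> * of_real (p k) * v k))
      + w k * (?DU k \<bullet> ((\<i> * of_real (n k) * conv (U t) (U t) k - \<i> * of_real (r k) * Z t k)
        - (\<i> * of_real (n k) * conv v v k - \<i> * of_real (r k) * z k)))
    = Re (c1 k * conv (Z t) ?DU k + c1 k * conv v ?DZ k + (c2 k * conv (U t) ?DU k + c2 k * conv v ?DU k))" for k
  proof -
    \<comment> \<open>With X and Y the errors in \<zeta> and u, the linear terms combine to -w' r'
      Re (i (cnj X * Y + cnj Y * X)), which is 0 because the inner bracket is real.\<close>
    have *: "x \<bullet> ((\<i> * of_real m' * a - \<i> * of_real (w' * r') * u) - (\<i> * of_real m' * a' - \<i> * of_real (w' * r') * u'))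
      + w' * ((u - u') \<bullet> ((\<i> * of_real n' * b - \<i> * of_real r' * y) - (\<i> * of_real n' * b' - \<i> * of_real r' * y')))
      = Re (cnj x * (\<i> * of_real m') * (a - a') + of_real w' * cnj (u - u') * (\<i> * of_real n') * (b - b'))"
      if "x = y - y'" for x y y' u u' a a' b b' :: complex and m' n' r' w' :: real
      unfolding that inner_complex_def by (simp add: algebra_simps)
    show ?thesis
      unfolding p_eq *[OF refl]
      unfolding conv_mult_diff[OF Zt(1) Ut(1) z(1) v(1)] conv_mult_diff[OF Ut(1) Ut(1) v(1) v(1)]
        c1_def c2_def distrib_left add.assoc ..
  qed
  have "?lhs = Re ((\<Sum>k\<in>K. c1 k * conv (Z t) ?DU k) + (\<Sum>k\<in>K. c1 k * conv v ?DZ k)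
      + ((\<Sum>k\<in>K. c2 k * conv (U t) ?DU k) + (\<Sum>k\<in>K. c2 k * conv v ?DU k)))"
    unfolding term_eq by (simp add: sum.distrib)
  also have "\<dots> \<le> cmod (\<Sum>k\<in>K. c1 k * conv (Z t) ?DU k) + cmod (\<Sum>k\<in>K. c1 k * conv v ?DZ k)
      + (cmod (\<Sum>k\<in>K. c2 k * conv (U t) ?DU k) + cmod (\<Sum>k\<in>K. c2 k * conv v ?DU k))"
    by (rule order_trans[OF complex_Re_le_cmod]) (intro norm_triangle_mono order_refl)
  also have "\<dots> \<le> (m0 * sqrt E) * q * L + (m0 * sqrt E) * q * V + ((n0 * sqrt E) * q * L + (n0 * sqrt E) * q * V)"
    by (intro add_mono sum_mult_conv_le[OF fin nonneg(1) c1 _ q(1)] sum_mult_conv_le[OF fin nonneg(2) c2 _ q(1)] DZ DU Zt Ut v(1) V)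
  also have "\<dots> = (sqrt E * q) * ((m0 + n0) * (L + V))" by (simp add: algebra_simps)
  also have "\<dots> \<le> (q * q) * ((m0 + n0) * (L + V))"
    by (intro mult_right_mono mult_nonneg_nonneg Eq q(1))
      (use m0 n0 L_nonneg S_nonneg w0 in \<open>auto simp: V_def\<close>)
  also have "\<dots> = rate * (\<delta> + E)"
    using q(2) by (simp add: power2_eq_square rate_def V_def)
  finally show ?thesis by (simp add: \<delta>_def)
qed

text \<open>The equations are demanded only at times with energy below 1. A solution of the
  truncated system can meet this demand as well as a true Galerkin solution, and the conclusion that
  the energy stays below 1 is what later removes the truncation. N0 is chosen so that C N^(-2s) is
  below 1, which is the smallness hypothesis of the bootstrap.\<close>

lemma galerkin_error:
  obtains C N0 where "C \<ge> 0" "N0 \<ge> 1"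
    "\<And>N K z v t. N \<ge> N0 \<Longrightarrow> K = {- int N..int N} \<Longrightarrow>
      (\<And>t k. t \<in> {0..T} \<Longrightarrow> k \<notin> K \<Longrightarrow> z t k = 0) \<Longrightarrow>
      (\<And>t k. t \<in> {0..T} \<Longrightarrow> k \<notin> K \<Longrightarrow> v t k = 0) \<Longrightarrow>
      (\<And>k. k \<in> K \<Longrightarrow> z 0 k = Z 0 k) \<Longrightarrow> (\<And>k. k \<in> K \<Longrightarrow> v 0 k = U 0 k) \<Longrightarrow>
      (\<And>k. k \<in> K \<Longrightarrow> continuous_on {0..T} (\<lambda>t. z t k)) \<Longrightarrow>
      (\<And>k. k \<in> K \<Longrightarrow> continuous_on {0..T} (\<lambda>t. v t k)) \<Longrightarrow>
      (\<And>t k. k \<in> K \<Longrightarrow> t \<in> {0..T} \<Longrightarrow> energy K z v t < 1 \<Longrightarrow>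
        ((\<lambda>\<tau>. z \<tau> k) has_vector_derivative
          \<i> * of_real (m k) * conv (z t) (v t) k - \<i> * of_real (p k) * v t k) (at t within {0..T})) \<Longrightarrow>
      (\<And>t k. k \<in> K \<Longrightarrow> t \<in> {0..T} \<Longrightarrow> energy K z v t < 1 \<Longrightarrow>
        ((\<lambda>\<tau>. v \<tau> k) has_vector_derivative
          \<i> * of_real (n k) * conv (v t) (v t) k - \<i> * of_real (r k) * z t k) (at t within {0..T})) \<Longrightarrow>
      t \<in> {0..T} \<Longrightarrow> energy K z v t < 1 \<and> energy K z v t \<le> C * (real N powr - s)\<^sup>2"
proof -
  define C where "C = M * exp (2 * rate * T)"
  have C: "C \<ge> 0" using M_nonneg by (simp add: C_def)
  have "((\<lambda>N. real N powr - s) \<longlonglongrightarrow> 0)"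
    by (rule tendsto_neg_powr) (use s filterlim_real_sequentially in auto)
  then have "(\<lambda>N. C * (real N powr - s)\<^sup>2) \<longlonglongrightarrow> C * 0\<^sup>2" by (intro tendsto_intros)
  then have "\<forall>\<^sub>F N in sequentially. C * (real N powr - s)\<^sup>2 < 1"
    by (rule order_tendstoD) simp
  then obtain N1 where N1: "\<And>N. N \<ge> N1 \<Longrightarrow> C * (real N powr - s)\<^sup>2 < 1"
    unfolding eventually_sequentially by blast
  show thesis
  proof (rule that[OF C])
    show "max N1 1 \<ge> 1" by simp
    fix N :: nat and K z v t
    assume N: "N \<ge> max N1 1" and K: "K = {- int N..int N}"
      and supp: "\<And>t k. t \<in> {0..T} \<Longrightarrow> k \<notin> K \<Longrightarrow> z t k = 0"
        "\<And>t k. t \<in> {0..T} \<Longrightarrow> k \<notin> K \<Longrightarrow> v t k = 0"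
      and init: "\<And>k. k \<in> K \<Longrightarrow> z 0 k = Z 0 k" "\<And>k. k \<in> K \<Longrightarrow> v 0 k = U 0 k"
      and cont: "\<And>k. k \<in> K \<Longrightarrow> continuous_on {0..T} (\<lambda>t. z t k)"
        "\<And>k. k \<in> K \<Longrightarrow> continuous_on {0..T} (\<lambda>t. v t k)"
      and dz: "\<And>t k. k \<in> K \<Longrightarrow> t \<in> {0..T} \<Longrightarrow> energy K z v t < 1 \<Longrightarrow>
        ((\<lambda>\<tau>. z \<tau> k) has_vector_derivative
          \<i> * of_real (m k) * conv (z t) (v t) k - \<i> * of_real (p k) * v t k) (at t within {0..T})"
      and dv: "\<And>t k. k \<in> K \<Longrightarrow> t \<in> {0..T} \<Longrightarrow> energy K z v t < 1 \<Longrightarrow>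
        ((\<lambda>\<tau>. v \<tau> k) has_vector_derivative
          \<i> * of_real (n k) * conv (v t) (v t) k - \<i> * of_real (r k) * z t k) (at t within {0..T})"
      and t: "t \<in> {0..T}"
    let ?\<delta> = "M * (real N powr - s)\<^sup>2"
    have "energy K z v t \<le> ?\<delta> * exp ((2 * rate) * T)"
    proof (rule bootstrap_gronwall[OF _ _ _ _ _ _ t])
      have Zc: "continuous_on {0..T} (\<lambda>t. Z t k)" "continuous_on {0..T} (\<lambda>t. U t k)" for k
        using Z_deriv U_deriv has_vector_derivative_continuous continuous_on_eq_continuous_within by blast+
      show "continuous_on {0..T} (energy K z v)"
        unfolding energy_def by (intro continuous_intros Zc cont)
      show "energy K z v 0 = 0" unfolding energy_def by (simp add: init)
      show "0 \<le> 2 * rate" using rate_nonneg by simp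
      show "0 \<le> ?\<delta>" using M_nonneg by simp
      show "?\<delta> * exp ((2 * rate) * T) < 1" using N1[of N] N by (simp add: C_def mult_ac)
      fix t assume t: "t \<in> {0..T}" and lt: "energy K z v t < 1"
      have sq: "((\<lambda>\<tau>. (cmod (f \<tau>))\<^sup>2) has_real_derivative 2 * (f t \<bullet> f')) (at t within {0..T})"
        if "(f has_vector_derivative f') (at t within {0..T})" for f :: "real \<Rightarrow> complex" and f'
      proof -
        have "((\<lambda>\<tau>. f \<tau> \<bullet> f \<tau>) has_derivative (\<lambda>h. f t \<bullet> (h *\<^sub>R f') + (h *\<^sub>R f') \<bullet> f t)) (at t within {0..T})"
          using that unfolding has_vector_derivative_def by (intro has_derivative_inner)
        then show ?thesis unfolding has_field_derivative_def power2_norm_eq_inner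
          by (rule has_derivative_eq_rhs) (auto simp: inner_commute)
      qed
      let ?D = "\<Sum>k\<in>K. 2 * ((Z t k - z t k) \<bullet> ((\<i> * of_real (m k) * conv (Z t) (U t) k - \<i> * of_real (p k) * U t k)
        - (\<i> * of_real (m k) * conv (z t) (v t) k - \<i> * of_real (p k) * v t k)))
      + w k * (2 * ((U t k - v t k) \<bullet> ((\<i> * of_real (n k) * conv (U t) (U t) k - \<i> * of_real (r k) * Z t k)
        - (\<i> * of_real (n k) * conv (v t) (v t) k - \<i> * of_real (r k) * z t k))))"
      let ?R = "\<Sum>k\<in>K. ((Z t k - z t k) \<bullet> ((\<i> * of_real (m k) * conv (Z t) (U t) k - \<i> * of_real (p k) * U t k)
        - (\<i> * of_real (m k) * conv (z t) (v t) k - \<i> * of_real (p k) * v t k)))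
      + w k * ((U t k - v t k) \<bullet> ((\<i> * of_real (n k) * conv (U t) (U t) k - \<i> * of_real (r k) * Z t k)
        - (\<i> * of_real (n k) * conv (v t) (v t) k - \<i> * of_real (r k) * z t k)))"
      have "(energy K z v has_real_derivative ?D) (at t within {0..T})"
        unfolding energy_def
        by (intro DERIV_sum DERIV_add DERIV_cmult sq has_vector_derivative_diff Z_deriv U_deriv dz dv t lt)
      moreover have "?D \<le> 2 * rate * (?\<delta> + energy K z v t)"
      proof -
        have eq: "energy K (\<lambda>_. z t) (\<lambda>_. v t) t = energy K z v t" by (simp add: energy_def)
        have supp': "\<forall>k. k \<notin> K \<longrightarrow> z t k = 0" "\<forall>k. k \<notin> K \<longrightarrow> v t k = 0" using supp t by auto
        have "N \<ge> 1" "energy K z v t \<le> 1" using N lt by auto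
        then have le: "?R \<le> rate * (?\<delta> + energy K z v t)"
          using energy_rate_le[where z = "z t" and v = "v t", OF t _ K supp' refl, unfolded eq] by blast
        have "?D = 2 * ?R"
          unfolding sum_distrib_left distrib_left[of 2] mult.left_commute[of 2] ..
        then show ?thesis using le by simp
      qed
      ultimately show "\<exists>D. (energy K z v has_real_derivative D) (at t within {0..T}) \<and>
          D \<le> 2 * rate * (?\<delta> + energy K z v t)" by blast
    qed
    also have "\<dots> = C * (real N powr - s)\<^sup>2" by (simp add: C_def mult_ac)
    finally show "energy K z v t < 1 \<and> energy K z v t \<le> C * (real N powr - s)\<^sup>2"
      using N1[of N] N by simp
  qed
qed

end

section \<open>Bounds on the symbols\<close>

text \<open>As coth x - 1 = exp(-x) / sinh x, the upper bound reduces to x exp(-x) <= sinh x, which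
  is 1 + 2x <= exp(2x) in disguise.\<close>

lemma mult_coth_bounds:
  fixes x :: real
  assumes "x > 0"
  shows "x \<le> x * coth x" "x * coth x \<le> 1 + x"
proof -
  have sh: "sinh x > 0" using assms by simp
  have "sinh x \<le> cosh x" by (simp add: sinh_le_cosh_real)
  then show "x \<le> x * coth x" using assms sh by (simp add: coth_def field_simps)
  have "x * exp (- x) \<le> sinh x"
  proof -
    have "2 * x + 1 \<le> exp (x + x)" using exp_ge_add_one_self[of "2 * x"] by (simp add: add.commute)
    then have "(2 * x + 1) * exp (- x) \<le> exp (x + x) * exp (- x)" by (rule mult_right_mono) simp
    also have "\<dots> = exp x" by (simp flip: exp_add)
    finally show ?thesis by (simp add: sinh_field_def exp_minus field_simps)
  qed
  moreover have "exp (- x) = cosh x - sinh x" by (simp add: cosh_minus_sinh)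
  ultimately have "x * cosh x \<le> (1 + x) * sinh x" by (simp add: algebra_simps)
  then show "x * coth x \<le> 1 + x" using sh by (simp add: coth_def field_simps)
qed

text \<open>With Y = |\<kappa>| coth|\<kappa>| / \<gamma> the symbol is (1 - Y + Y^2) / \<gamma>,
  and 1 - Y + Y^2 = 1/2 + Y^2/2 + (1 - Y)^2/2 is positive for every Y. The value at \<kappa> = 0
  corresponds to |\<kappa>| coth|\<kappa>| = 1, its limit. The constant 5 is generous; only the
  order 1 + \<kappa>^2 matters.\<close>

lemma g_symbol_bounds:
  fixes \<gamma> \<kappa> :: real
  assumes \<gamma>: "0 < \<gamma>" "\<gamma> < 1"
  shows "(1 + \<kappa>\<^sup>2) / 2 \<le> g_symbol \<gamma> 0 \<kappa>" "g_symbol \<gamma> 0 \<kappa> \<le> 5 / \<gamma>^3 * (1 + \<kappa>\<^sup>2)"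
proof -
  obtain y where y: "\<bar>\<kappa>\<bar> \<le> y" "y \<le> 1 + \<bar>\<kappa>\<bar>" "g_symbol \<gamma> 0 \<kappa> = 1/\<gamma> - 1/\<gamma>^2 * y + 1/\<gamma>^3 * y\<^sup>2"
  proof (cases "\<kappa> = 0")
    case True
    then show ?thesis by (intro that[of 1]) (auto simp: g_symbol_def)
  next
    case False
    then show ?thesis using mult_coth_bounds[of "\<bar>\<kappa>\<bar>"]
      by (intro that[of "\<bar>\<kappa>\<bar> * coth \<bar>\<kappa>\<bar>"]) (auto simp: g_symbol_def power_mult_distrib)
  qed
  define Y where "Y = y / \<gamma>"
  have g: "g_symbol \<gamma> 0 \<kappa> = (1 - Y + Y\<^sup>2) / \<gamma>"
    using \<gamma> unfolding y(3) Y_def by (simp add: field_simps power2_eq_square power3_eq_cube)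
  have y0: "y \<ge> 0" using y(1) by linarith
  have "y * \<gamma> \<le> y" using \<gamma> y0 by (simp add: mult_left_le)
  then have "y \<le> Y" using \<gamma> by (simp add: Y_def field_simps)
  then have "\<bar>\<kappa>\<bar> \<le> Y" using y(1) by linarith
  then have YK: "\<kappa>\<^sup>2 \<le> Y\<^sup>2" using abs_le_square_iff[of \<kappa> Y] by simp
  have "1 - Y + Y\<^sup>2 = 1/2 + Y\<^sup>2 / 2 + (1 - Y)\<^sup>2 / 2" by (simp add: power2_eq_square field_simps)
  moreover have "(1 - Y)\<^sup>2 / 2 \<ge> 0" by simp
  ultimately have l: "(1 + \<kappa>\<^sup>2) / 2 \<le> 1 - Y + Y\<^sup>2" using YK unfolding add_divide_distrib by linarith
  also have "\<dots> \<le> (1 - Y + Y\<^sup>2) / \<gamma>"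
  proof -
    have "0 \<le> (1 + \<kappa>\<^sup>2) / 2" by simp
    with l have "0 \<le> 1 - Y + Y\<^sup>2" by linarith
    then have "(1 - Y + Y\<^sup>2) * \<gamma> \<le> 1 - Y + Y\<^sup>2" using \<gamma> by (intro mult_left_le) auto
    then show ?thesis using \<gamma> by (simp add: field_simps)
  qed
  finally show "(1 + \<kappa>\<^sup>2) / 2 \<le> g_symbol \<gamma> 0 \<kappa>" unfolding g .
  have "y\<^sup>2 \<le> (1 + \<bar>\<kappa>\<bar>)\<^sup>2" using y(2) y0 by (intro power_mono)
  also have "\<dots> \<le> 2 * (1 + \<kappa>\<^sup>2)"
    using sum_squares_bound[of 1 "\<bar>\<kappa>\<bar>"] by (simp add: power2_sum)
  finally have yk: "y\<^sup>2 \<le> 2 * (1 + \<kappa>\<^sup>2)" .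
  have g2: "\<gamma>\<^sup>2 \<le> 1" "\<gamma>\<^sup>2 > 0" using \<gamma> by (auto simp: power_le_one)
  have "1 - Y + Y\<^sup>2 \<le> 1 + Y\<^sup>2" using y0 \<gamma> by (simp add: Y_def)
  also have "\<dots> \<le> (1 + y\<^sup>2) / \<gamma>\<^sup>2"
    using g2 by (simp add: Y_def power_divide add_divide_distrib)
  also have "\<dots> \<le> (5 * (1 + \<kappa>\<^sup>2)) / \<gamma>\<^sup>2"
  proof (rule divide_right_mono)
    have "0 \<le> \<kappa>\<^sup>2" by simp
    with yk show "1 + y\<^sup>2 \<le> 5 * (1 + \<kappa>\<^sup>2)" unfolding distrib_left mult_1_right by linarith
  qed simp
  finally have "(1 - Y + Y\<^sup>2) / \<gamma> \<le> (5 * (1 + \<kappa>\<^sup>2)) / \<gamma>\<^sup>2 / \<gamma>" using \<gamma> by (intro divide_right_mono) auto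
  then show "g_symbol \<gamma> 0 \<kappa> \<le> 5 / \<gamma>^3 * (1 + \<kappa>\<^sup>2)"
    unfolding g by (simp add: power2_eq_square power3_eq_cube mult_ac)
qed

text \<open>Obtained by solving \<open>zeta_lin\<close> = w * \<open>u_lin\<close> for w at \<kappa>
  \<noteq> 0; it is positive because \<gamma> < 1 and g > 0.\<close>

definition energy_weight :: "real \<Rightarrow> real \<Rightarrow> real \<Rightarrow> real \<Rightarrow> real" where
  "energy_weight \<gamma> b d \<kappa> = g_symbol \<gamma> 0 \<kappa> * (1 + d * \<kappa>\<^sup>2) / ((1 + b * \<kappa>\<^sup>2) * (1 - \<gamma>))"

text \<open>The quotient (1 + d \<kappa>^2) / (1 + b \<kappa>^2) lies between 1 and d/b, the lower
  bound of g contributes the factor 1/2, and dividing by 1 - \<gamma> < 1 only increases.\<close>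

lemma energy_weight_ge:
  fixes \<gamma> b d \<kappa> :: real
  assumes \<gamma>: "0 < \<gamma>" "\<gamma> < 1" and bd: "b > 0" "d > 0"
  shows "min 1 (d / b) / 2 * (1 + \<kappa>\<^sup>2) \<le> energy_weight \<gamma> b d \<kappa>"
proof -
  define e where "e = min 1 (d / b)"
  have e: "e > 0" "e \<le> 1" "e * b \<le> d" using bd by (auto simp: e_def min_def field_simps)
  have B: "1 + b * \<kappa>\<^sup>2 > 0" using bd by (simp add: add_pos_nonneg)
  have "e * (1 + b * \<kappa>\<^sup>2) \<le> 1 + d * \<kappa>\<^sup>2"
    using e mult_right_mono[OF e(3), of "\<kappa>\<^sup>2"] by (simp add: algebra_simps)
  then have "e \<le> (1 + d * \<kappa>\<^sup>2) / (1 + b * \<kappa>\<^sup>2)" using B by (simp add: field_simps)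
  then have "(1 + \<kappa>\<^sup>2) / 2 * e \<le> g_symbol \<gamma> 0 \<kappa> * ((1 + d * \<kappa>\<^sup>2) / (1 + b * \<kappa>\<^sup>2))"
    using g_symbol_bounds(1)[OF \<gamma>, of \<kappa>] order_trans[OF _ g_symbol_bounds(1)[OF \<gamma>, of \<kappa>], of 0] e
    by (intro mult_mono) auto
  also have "\<dots> \<le> g_symbol \<gamma> 0 \<kappa> * ((1 + d * \<kappa>\<^sup>2) / (1 + b * \<kappa>\<^sup>2)) / (1 - \<gamma>)"
  proof -
    define X where "X = g_symbol \<gamma> 0 \<kappa> * ((1 + d * \<kappa>\<^sup>2) / (1 + b * \<kappa>\<^sup>2))"
    have "0 \<le> (1 + \<kappa>\<^sup>2) / 2 * e" using e by simp
    with calculation have "0 \<le> X" unfolding X_def by linarith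
    then have "X * (1 - \<gamma>) \<le> X" using \<gamma> by (intro mult_left_le) auto
    then show ?thesis unfolding X_def [symmetric] using \<gamma> by (simp add: field_simps)
  qed
  also have "\<dots> = energy_weight \<gamma> b d \<kappa>" by (simp add: energy_weight_def)
  finally show ?thesis by (simp add: e_def mult_ac)
qed

lemma bbm_multiplier_le:
  fixes b \<kappa> :: real
  assumes b: "b > 0"
  shows "\<bar>\<kappa> / (1 + b * \<kappa>\<^sup>2)\<bar> \<le> 1 + 1 / b"
proof -
  have B: "1 + b * \<kappa>\<^sup>2 > 0" using b by (simp add: add_pos_nonneg)
  have "2 * \<bar>\<kappa>\<bar> \<le> b * \<bar>\<kappa>\<bar>\<^sup>2 + 1 / b" by (rule two_mult_le[OF b])
  also have "\<dots> \<le> (1 + 1 / b) * (1 + b * \<kappa>\<^sup>2)" using b by (simp add: algebra_simps)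
  finally have "\<bar>\<kappa>\<bar> \<le> (1 + 1 / b) * (1 + b * \<kappa>\<^sup>2)" by linarith
  then show ?thesis using B by (simp add: abs_divide pos_divide_le_eq)
qed

text \<open>The weight grows like \<kappa>^2 while the multiplier decays like 1/|\<kappa>|: this is
  where d > 0 pays for the H^1 weight on u. The factors are paired as (1 + \<kappa>^2) / B and
  \<kappa>^2 / D, each of them bounded.\<close>

lemma energy_weight_mult_le:
  fixes \<gamma> b d \<kappa> :: real
  assumes \<gamma>: "0 < \<gamma>" "\<gamma> < 1" and bd: "b > 0" "d > 0"
  shows "energy_weight \<gamma> b d \<kappa> * (\<kappa> / (1 + d * \<kappa>\<^sup>2))\<^sup>2 \<le> 5 / \<gamma>^3 * (1 + 1 / b) / d / (1 - \<gamma>)"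
proof -
  define B D where "B = 1 + b * \<kappa>\<^sup>2" and "D = 1 + d * \<kappa>\<^sup>2"
  have B: "B > 0" and D: "D > 0" using bd by (auto simp: add_pos_nonneg B_def D_def)
  have "0 \<le> \<kappa>\<^sup>2" by simp
  then have "1 + \<kappa>\<^sup>2 \<le> (1 + 1 / b) * B" using bd by (simp add: B_def algebra_simps)
  then have 1: "(1 + \<kappa>\<^sup>2) / B \<le> 1 + 1 / b" using B by (simp add: field_simps)
  have 2: "\<kappa>\<^sup>2 / D \<le> 1 / d" using bd D by (simp add: D_def field_simps)
  have "energy_weight \<gamma> b d \<kappa> * (\<kappa> / D)\<^sup>2 = g_symbol \<gamma> 0 \<kappa> * (\<kappa>\<^sup>2 / (B * D)) / (1 - \<gamma>)"
    unfolding energy_weight_def B_def [symmetric] D_def [symmetric]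
    using B D by (simp add: power_divide power2_eq_square)
  also have "\<dots> \<le> (5 / \<gamma>^3 * (1 + \<kappa>\<^sup>2)) * (\<kappa>\<^sup>2 / (B * D)) / (1 - \<gamma>)"
    by (intro divide_right_mono mult_right_mono g_symbol_bounds(2)) (use \<gamma> B D in auto)
  also have "\<dots> = 5 / \<gamma>^3 * ((1 + \<kappa>\<^sup>2) / B * (\<kappa>\<^sup>2 / D)) / (1 - \<gamma>)" by simp
  also have "\<dots> \<le> 5 / \<gamma>^3 * ((1 + 1 / b) * (1 / d)) / (1 - \<gamma>)"
    by (intro divide_right_mono mult_left_mono mult_mono 1 2) (use \<gamma> B D bd in auto)
  finally show ?thesis by (simp add: D_def)
qed

section \<open>Solvability of the truncated Galerkin system\<close>

text \<open>The Picard operator acts on bounded continuous functions on the whole line, a complete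
  metric space, for the rescaled unknown exp(-c t) y(t). Its contraction factor is L/c <= 1/2, so no
  continuation of local solutions is needed.\<close>

lemma lipschitz_ode_exists:
  fixes F :: "'a::banach \<Rightarrow> 'a"
  assumes L: "L \<ge> 0" and lip: "\<And>x y. dist (F x) (F y) \<le> L * dist x y" and T: "T > 0"
  obtains y where "y 0 = init"
    "\<And>t. t \<in> {0..T} \<Longrightarrow> (y has_vector_derivative F (y t)) (at t within {0..T})"
proof -
  \<comment> \<open>The weight \<open>exp (- c * t)\<close> makes the Picard operator contractive on all of \<open>{0..T}\<close> at once.\<close>
  define c where "c = 2 * L + 1"
  have c: "c > 0" "L / c \<le> 1 / 2" using L by (auto simp: c_def field_simps)
  have Fc: "continuous_on S F" for S
  proof (rule continuous_on_subset)
    have "\<forall>x. \<forall>e>0. \<exists>d>0. \<forall>x'. dist x' x < d \<longrightarrow> dist (F x') (F x) < e"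
    proof (intro allI impI)
      fix x and e :: real assume e: "e > 0"
      have "dist (F x') (F x) < e" if "dist x' x < e / (L + 1)" for x'
      proof -
        have "dist (F x') (F x) \<le> (L + 1) * dist x' x" using lip[of x' x] zero_le_dist[of x' x] unfolding distrib_right mult_1_left by linarith
        also have "\<dots> < e" using that L by (simp add: field_simps)
        finally show ?thesis .
      qed
      then show "\<exists>d>0. \<forall>x'. dist x' x < d \<longrightarrow> dist (F x') (F x) < e"
        using e L by (intro exI[of _ "e / (L + 1)"]) auto
    qed
    then show "continuous_on UNIV F" unfolding continuous_on_iff by simp
  qed simp
  define J where "J x s = F (exp (c * s) *\<^sub>R apply_bcontfun x s)" for x :: "real \<Rightarrow>\<^sub>C 'a" and s
  have Jc: "continuous_on S (J x)" for x S
    unfolding J_def by (intro continuous_on_compose2[OF Fc[of UNIV]] continuous_intros) auto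
  define h where "h x t = exp (- c * t) *\<^sub>R (init + integral {0..t} (J x))" for x t
  have hc: "continuous_on {0..T} (h x)" for x
    unfolding h_def
    by (intro continuous_intros indefinite_integral_continuous_1 integrable_continuous_real Jc)
  \<comment> \<open>Clamping time to [0,T] extends the Picard image to the whole line and keeps it
    bounded, since only values attained on a compact interval occur.\<close>
  define cl where "cl t = max 0 (min T t)" for t
  have cl: "cl t \<in> {0..T}" for t using T by (auto simp: cl_def)
  have cl_id: "cl t = t" if "t \<in> {0..T}" for t using that by (auto simp: cl_def)
  have hb: "(\<lambda>t. h x (cl t)) \<in> bcontfun" for x
  proof -
    have "continuous_on UNIV (\<lambda>t. h x (cl t))"
    proof (rule continuous_on_compose2[OF hc])
      show "continuous_on UNIV cl" unfolding cl_def by (intro continuous_intros)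
    qed (use cl in auto)
    moreover have "bounded (h x ` {0..T})"
      by (intro compact_imp_bounded compact_continuous_image hc) simp
    then have "bounded (range (\<lambda>t. h x (cl t)))"
      by (rule bounded_subset) (use cl in auto)
    ultimately show ?thesis by (simp add: bcontfun_def)
  qed
  define \<Phi> where "\<Phi> x = Bcontfun (\<lambda>t. h x (cl t))" for x
  have \<Phi>: "apply_bcontfun (\<Phi> x) t = h x (cl t)" for x t
    unfolding \<Phi>_def using hb by (simp add: Bcontfun_inverse)
  have "dist (\<Phi> x) (\<Phi> x') \<le> 1 / 2 * dist x x'" for x x'
  proof (rule dist_bound)
    fix t
    define r where "r = cl t"
    have r: "r \<ge> 0" using cl[of t] by (simp add: r_def)
    let ?D = "dist x x'"
    have "((\<lambda>s. (L * ?D / c) * exp (c * s)) has_vector_derivative L * ?D * exp (c * s)) (at s within {0..r})" for s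
      unfolding has_real_derivative_iff_has_vector_derivative [symmetric]
      using c by (auto intro!: derivative_eq_intros)
    then have hi: "((\<lambda>s. L * ?D * exp (c * s)) has_integral (L * ?D / c) * exp (c * r) - (L * ?D / c) * exp (c * 0)) {0..r}"
      by (intro fundamental_theorem_of_calculus r)
    have "norm (integral {0..r} (\<lambda>s. J x s - J x' s)) \<le> integral {0..r} (\<lambda>s. L * ?D * exp (c * s))"
    proof (rule Henstock_Kurzweil_Integration.integral_norm_bound_integral)
      show "(\<lambda>s. J x s - J x' s) integrable_on {0..r}"
        by (intro integrable_continuous_real continuous_intros Jc)
      show "(\<lambda>s. L * ?D * exp (c * s)) integrable_on {0..r}" using hi by blast
      fix s
      have "norm (J x s - J x' s) \<le> L * dist (exp (c * s) *\<^sub>R apply_bcontfun x s) (exp (c * s) *\<^sub>R apply_bcontfun x' s)"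
        unfolding J_def dist_norm [symmetric] by (rule lip)
      also have "\<dots> = L * (exp (c * s) * dist (apply_bcontfun x s) (apply_bcontfun x' s))"
        by (simp add: dist_norm flip: scaleR_diff_right)
      also have "\<dots> \<le> L * (exp (c * s) * ?D)"
        by (intro mult_left_mono dist_bounded L) simp
      finally show "norm (J x s - J x' s) \<le> L * ?D * exp (c * s)" by (simp add: mult_ac)
    qed
    also have "\<dots> = (L / c) * ?D * (exp (c * r) - 1)"
      unfolding integral_unique[OF hi] by (simp add: algebra_simps diff_divide_distrib)
    also have "\<dots> \<le> 1 / 2 * ?D * exp (c * r)"
      by (intro mult_mono c) (use c r in auto)
    finally have bd: "norm (integral {0..r} (\<lambda>s. J x s - J x' s)) \<le> 1 / 2 * ?D * exp (c * r)" .
    have "dist (\<Phi> x t) (\<Phi> x' t) = exp (- c * r) * norm (integral {0..r} (J x) - integral {0..r} (J x'))"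
      unfolding \<Phi> h_def r_def [symmetric] dist_norm by (simp flip: scaleR_diff_right)
    also have "integral {0..r} (J x) - integral {0..r} (J x') = integral {0..r} (\<lambda>s. J x s - J x' s)"
      by (rule integral_diff[symmetric]; intro integrable_continuous_real Jc)
    also have "exp (- c * r) * norm \<dots> \<le> exp (- c * r) * (1 / 2 * ?D * exp (c * r))"
      by (intro mult_left_mono bd) simp
    also have "\<dots> = 1 / 2 * ?D * (exp (- c * r) * exp (c * r))" by simp
    also have "\<dots> = 1 / 2 * ?D" by (simp flip: exp_add)
    finally show "dist (\<Phi> x t) (\<Phi> x' t) \<le> 1 / 2 * ?D" .
  qed
  then obtain x where x: "\<Phi> x = x" using banach_fix_type[of "1 / 2" \<Phi>] by auto
  define y where "y t = exp (c * t) *\<^sub>R apply_bcontfun x t" for t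
  have y_eq: "y t = init + integral {0..t} (J x)" if "t \<in> {0..T}" for t
  proof -
    have "apply_bcontfun x t = h x t" using \<Phi>[of x t] that by (simp add: x cl_id)
    then show ?thesis by (simp add: y_def h_def flip: exp_add)
  qed
  show thesis
  proof (rule that)
    show "y 0 = init" using y_eq[of 0] T by simp
    fix t assume t: "t \<in> {0..T}"
    have "((\<lambda>u. init + integral {0..u} (J x)) has_vector_derivative (0 + J x t)) (at t within {0..T})"
      by (intro has_vector_derivative_add has_vector_derivative_const integral_has_vector_derivative Jc t)
    moreover have "0 + J x t = F (y t)" by (simp add: J_def y_def)
    ultimately show "(y has_vector_derivative F (y t)) (at t within {0..T})"
      by (intro has_vector_derivative_transform[OF t y_eq]) simp_all
  qed
qed

lemma conv_finite_support:
  assumes "finite K" "\<And>k. k \<notin> K \<Longrightarrow> a k = 0"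
  shows "conv a b k = (\<Sum>l\<in>K. a l * b (k - l))"
proof -
  have "conv a b k = (\<Sum>\<^sub>\<infinity>l\<in>K. a l * b (k - l))"
    unfolding conv_def by (rule infsum_cong_neutral) (use assms in auto)
  then show ?thesis using assms by simp
qed

text \<open>The coefficient space is \<open>int discrete \<Rightarrow>\<^sub>C complex \<times> complex\<close>, which is a Banach space;
  \<open>int\<close> itself is not a metric space, so it cannot be used as the index type.\<close>

instance bcontfun :: (metric_space, banach) banach ..

text \<open>Projection onto a disc is nonexpansive and bounded by \<open>R\<close>, so the truncated
  convolution is globally Lipschitz; the linear terms are so already, as \<open>K\<close> is finite,
  and are left alone. The Lipschitz constant may depend on \<open>K\<close> and \<open>R\<close>,
  because only existence is at stake.\<close>

lemma truncated_galerkin_exists: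
  fixes m n p r :: "int \<Rightarrow> real" and z0 v0 :: "int \<Rightarrow> complex"
  assumes K: "finite K" and R: "R \<ge> 0" and T: "T > 0"
  defines "trunc \<equiv> \<lambda>y k. if k \<in> K then closest_point (cball 0 R) (y k) else (0 :: complex)"
  obtains z v :: "real \<Rightarrow> int \<Rightarrow> complex"
  where "\<And>t k. k \<notin> K \<Longrightarrow> z t k = 0" "\<And>t k. k \<notin> K \<Longrightarrow> v t k = 0"
    "\<And>k. k \<in> K \<Longrightarrow> z 0 k = z0 k" "\<And>k. k \<in> K \<Longrightarrow> v 0 k = v0 k"
    "\<And>t k. k \<in> K \<Longrightarrow> t \<in> {0..T} \<Longrightarrow> ((\<lambda>\<tau>. z \<tau> k) has_vector_derivative
      \<i> * of_real (m k) * conv (trunc (z t)) (trunc (v t)) k - \<i> * of_real (p k) * v t k) (at t within {0..T})"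
    "\<And>t k. k \<in> K \<Longrightarrow> t \<in> {0..T} \<Longrightarrow> ((\<lambda>\<tau>. v \<tau> k) has_vector_derivative
      \<i> * of_real (n k) * conv (trunc (v t)) (trunc (v t)) k - \<i> * of_real (r k) * z t k) (at t within {0..T})"
proof -
  let ?c = "closest_point (cball 0 R) :: complex \<Rightarrow> complex"
  have ne: "cball (0::complex) R \<noteq> {}" using R by simp
  have c_le: "cmod (?c x) \<le> R" for x
    using closest_point_in_set[OF closed_cball ne, of x] by simp
  have c_lip: "cmod (?c x - ?c y) \<le> cmod (x - y)" for x y
    using closest_point_lipschitz[OF convex_cball closed_cball ne, of x y] by (simp add: dist_norm)
  have tr_le: "cmod (trunc y k) \<le> R" for y k using c_le R by (simp add: trunc_def)
  have conv_lip: "cmod (conv (trunc a) (trunc b) k - conv (trunc a') (trunc b') k) \<le> real (card K) * (2 * R * D)"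
    if "D \<ge> 0" "\<And>k. cmod (a k - a' k) \<le> D" "\<And>k. cmod (b k - b' k) \<le> D" for a b a' b' D k
  proof -
    have tl: "cmod (trunc a k - trunc a' k) \<le> D" "cmod (trunc b k - trunc b' k) \<le> D" for k
      using that order_trans[OF c_lip] by (auto simp: trunc_def)
    have "conv (trunc a) (trunc b) k - conv (trunc a') (trunc b') k
      = (\<Sum>l\<in>K. trunc a l * (trunc b (k - l) - trunc b' (k - l)) + (trunc a l - trunc a' l) * trunc b' (k - l))"
      by (subst (1 2) conv_finite_support[OF K]) (auto simp: trunc_def algebra_simps simp flip: sum_subtractf)
    also have "cmod \<dots> \<le> (\<Sum>l\<in>K. R * D + D * R)"
    proof (rule order_trans[OF norm_sum], rule sum_mono)
      show "cmod (trunc a l * (trunc b (k - l) - trunc b' (k - l)) + (trunc a l - trunc a' l) * trunc b' (k - l))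
        \<le> R * D + D * R" for l
        by (rule order_trans[OF norm_triangle_ineq], unfold norm_mult)
          (intro add_mono mult_mono tr_le tl R that norm_ge_zero)
    qed
    finally show ?thesis by (simp add: algebra_simps)
  qed
  define f1 where "f1 a b k = \<i> * of_real (m k) * conv (trunc a) (trunc b) k - \<i> * of_real (p k) * b k" for a b k
  define f2 where "f2 a b k = \<i> * of_real (n k) * conv (trunc b) (trunc b) k - \<i> * of_real (r k) * a k" for a b k
  define f where "f x k = (if k \<in> K then (f1 (\<lambda>k. fst (x k)) (\<lambda>k. snd (x k)) k, f2 (\<lambda>k. fst (x k)) (\<lambda>k. snd (x k)) k) else 0)"
    for x :: "int \<Rightarrow> complex \<times> complex" and k
  have fin: "(\<lambda>i. if of_discrete i \<in> K then g (of_discrete i) else 0) \<in> bcontfun" for g :: "int \<Rightarrow> complex \<times> complex"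
  proof -
    have "range (\<lambda>i. if of_discrete i \<in> K then g (of_discrete i) else 0) \<subseteq> insert 0 (g ` K)" by auto
    then have "finite (range (\<lambda>i. if of_discrete i \<in> K then g (of_discrete i) else 0))"
      by (rule finite_subset) (use K in auto)
    moreover have "continuous_on UNIV (\<lambda>i. if of_discrete i \<in> K then g (of_discrete i) else 0)"
      by (simp add: continuous_on_open_vimage open_discrete)
    ultimately show ?thesis by (simp add: bcontfun_def finite_imp_bounded)
  qed
  define app where "app x k = apply_bcontfun x (discrete k)" for x :: "int discrete \<Rightarrow>\<^sub>C (complex \<times> complex)" and k
  define F where "F x = Bcontfun (\<lambda>i. f (app x) (of_discrete i))" for x
  have Fi: "apply_bcontfun (F x) i = f (app x) (of_discrete i)" for x i
  proof -
    have "(\<lambda>i. f h (of_discrete i)) \<in> bcontfun" for h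
      using fin[of "\<lambda>k. (f1 (\<lambda>k. fst (h k)) (\<lambda>k. snd (h k)) k, f2 (\<lambda>k. fst (h k)) (\<lambda>k. snd (h k)) k)"]
      by (simp only: f_def)
    then show ?thesis by (simp add: F_def Bcontfun_inverse)
  qed
  then have F: "app (F x) k = f (app x) k" for x k
    by (simp add: app_def discrete_inverse)
  define A where "A = (\<Sum>k\<in>K. \<bar>m k\<bar> + \<bar>n k\<bar> + \<bar>p k\<bar> + \<bar>r k\<bar>)"
  \<comment> \<open>\<open>A\<close> bounds all multipliers on \<open>K\<close>; the factor 2 is for
    the two components, each of which gets \<open>L / 2\<close>.\<close>
  define L where "L = 2 * (A * (real (card K) * (2 * R)) + A)"
  have A0: "A \<ge> 0" unfolding A_def by (intro sum_nonneg) auto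
  have A: "\<bar>m k\<bar> \<le> A" "\<bar>n k\<bar> \<le> A" "\<bar>p k\<bar> \<le> A" "\<bar>r k\<bar> \<le> A" if "k \<in> K" for k
    using member_le_sum[OF that, of "\<lambda>k. \<bar>m k\<bar> + \<bar>n k\<bar> + \<bar>p k\<bar> + \<bar>r k\<bar>"] K by (auto simp: A_def)
  have L0: "L \<ge> 0" unfolding L_def using A0 R by simp
  have lip: "dist (F x) (F x') \<le> L * dist x x'" for x x'
  proof (rule dist_bound)
    fix i :: "int discrete"
    define k where "k = of_discrete i"
    let ?D = "dist x x'"
    have D: "cmod (fst (app x k) - fst (app x' k)) \<le> ?D" "cmod (snd (app x k) - snd (app x' k)) \<le> ?D" for k
      using order_trans[OF dist_fst_le dist_bounded[of x "discrete k" x']]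
        order_trans[OF dist_snd_le dist_bounded[of x "discrete k" x']]
      by (auto simp: dist_norm app_def)
    have "dist (f (app x) k) (f (app x') k) \<le> L * ?D"
    proof (cases "k \<in> K")
      case False
      then show ?thesis using L0 by (simp add: f_def)
    next
      case True
      have half: "cmod ((\<i> * of_real q * C - \<i> * of_real q' * w) - (\<i> * of_real q * C' - \<i> * of_real q' * w')) \<le> L / 2 * ?D"
        if "\<bar>q\<bar> \<le> A" "\<bar>q'\<bar> \<le> A" "cmod (C - C') \<le> real (card K) * (2 * R * ?D)" "cmod (w - w') \<le> ?D" for q q' C C' w w'
      proof -
        have "(\<i> * of_real q * C - \<i> * of_real q' * w) - (\<i> * of_real q * C' - \<i> * of_real q' * w')
          = \<i> * of_real q * (C - C') - \<i> * of_real q' * (w - w')" by (simp add: algebra_simps)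
        also have "cmod \<dots> \<le> \<bar>q\<bar> * cmod (C - C') + \<bar>q'\<bar> * cmod (w - w')"
          by (rule order_trans[OF norm_triangle_ineq4]) (simp add: norm_mult)
        also have "\<dots> \<le> A * (real (card K) * (2 * R * ?D)) + A * ?D"
          by (intro add_mono mult_mono that) (use A0 in auto)
        finally show ?thesis by (simp add: L_def algebra_simps)
      qed
      let ?z = "\<lambda>k. fst (app x k)" and ?v = "\<lambda>k. snd (app x k)" and ?z' = "\<lambda>k. fst (app x' k)" and ?v' = "\<lambda>k. snd (app x' k)"
      have "cmod (f1 ?z ?v k - f1 ?z' ?v' k) \<le> L / 2 * ?D"
        unfolding f1_def by (intro half A True D conv_lip) auto
      moreover have "cmod (f2 ?z ?v k - f2 ?z' ?v' k) \<le> L / 2 * ?D"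
        unfolding f2_def by (intro half A True D conv_lip) auto
      moreover have "dist (f (app x) k) (f (app x') k) \<le> cmod (f1 ?z ?v k - f1 ?z' ?v' k) + cmod (f2 ?z ?v k - f2 ?z' ?v' k)"
        using True by (simp add: f_def dist_norm norm_Pair sqrt_sum_squares_le_sum)
      ultimately show ?thesis by (simp add: field_simps)
    qed
    then show "dist (F x i) (F x' i) \<le> L * ?D" by (simp add: Fi k_def)
  qed
  define init where "init = Bcontfun (\<lambda>i. if of_discrete i \<in> K then (z0 (of_discrete i), v0 (of_discrete i)) else 0)"
  obtain y where y0: "y 0 = init"
    and y: "\<And>t. t \<in> {0..T} \<Longrightarrow> (y has_vector_derivative F (y t)) (at t within {0..T})"
    using lipschitz_ode_exists[where F = F and init = init, OF L0 lip T] by blast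
  have y0': "app (y 0) k = (z0 k, v0 k)" if "k \<in> K" for k
    using that unfolding app_def y0 init_def Bcontfun_inverse[OF fin[of "\<lambda>k. (z0 k, v0 k)"]] by (simp add: discrete_inverse)
  have bl: "bounded_linear (\<lambda>x. app x k)" for k
    unfolding app_def by (rule bounded_linear_intro[of _ 1]) (auto intro: norm_bounded)
  define z where "z t k = (if k \<in> K then fst (app (y t) k) else 0)" for t k
  define v where "v t k = (if k \<in> K then snd (app (y t) k) else 0)" for t k
  have tz: "trunc (\<lambda>k. fst (app (y t) k)) = trunc (z t)"
    and tv: "trunc (\<lambda>k. snd (app (y t) k)) = trunc (v t)" for t
    by (auto simp: trunc_def z_def v_def fun_eq_iff)
  have dy: "((\<lambda>t. app (y t) k) has_vector_derivative f (app (y t)) k) (at t within {0..T})"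
    if "t \<in> {0..T}" for t k
    using bounded_linear.has_vector_derivative[OF bl y[OF that], of k] by (simp add: F)
  show thesis
  proof (rule that)
    fix t k assume k: "k \<in> K" and t: "t \<in> {0..T}"
    show "((\<lambda>\<tau>. z \<tau> k) has_vector_derivative
      \<i> * of_real (m k) * conv (trunc (z t)) (trunc (v t)) k - \<i> * of_real (p k) * v t k) (at t within {0..T})"
      using bounded_linear.has_vector_derivative[OF bounded_linear_fst dy[OF t, of k]] k
      by (simp add: f_def f1_def tz tv) (simp add: z_def v_def)
    show "((\<lambda>\<tau>. v \<tau> k) has_vector_derivative
      \<i> * of_real (n k) * conv (trunc (v t)) (trunc (v t)) k - \<i> * of_real (r k) * z t k) (at t within {0..T})"
      using bounded_linear.has_vector_derivative[OF bounded_linear_snd dy[OF t, of k]] k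
      by (simp add: f_def f2_def tz tv) (simp add: z_def v_def)
  qed (auto simp: z_def v_def y0')
qed

section \<open>Convergence of the Galerkin approximation\<close>

context dispersive_system
begin

definition galerkin_coeffs :: "int set \<Rightarrow> (real \<Rightarrow> int \<Rightarrow> complex) \<Rightarrow> (real \<Rightarrow> int \<Rightarrow> complex) \<Rightarrow> bool" where
  "galerkin_coeffs K z v \<longleftrightarrow>
     (\<forall>t\<in>{0..T}. \<forall>k. k \<notin> K \<longrightarrow> z t k = 0 \<and> v t k = 0) \<and>
     (\<forall>k\<in>K. z 0 k = Z 0 k \<and> v 0 k = U 0 k) \<and>
     (\<forall>k\<in>K. \<forall>t\<in>{0..T}.
        ((\<lambda>\<tau>. z \<tau> k) has_vector_derivative
          \<i> * of_real (m k) * conv (z t) (v t) k - \<i> * of_real (p k) * v t k) (at t within {0..T}) \<and>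
        ((\<lambda>\<tau>. v \<tau> k) has_vector_derivative
          \<i> * of_real (n k) * conv (v t) (v t) k - \<i> * of_real (r k) * z t k) (at t within {0..T}))"

text \<open>Provides a truncation radius independent of N: an exact coefficient is at most
  \<open>L\<close> in modulus, and an energy below 1 leaves at most \<open>1 / w0\<close> for the
  error, as w0 <= 1.\<close>

lemma energy_small_imp_bounded:
  assumes K: "finite K" and t: "t \<in> {0..T}" and e: "energy K z v t < 1" and k: "k \<in> K"
  shows "cmod (z t k) \<le> L + 1 / w0" "cmod (v t k) \<le> L + 1 / w0"
proof -
  have w1: "1 \<le> 1 / w0" using w0 by simp
  have le: "cmod x \<le> L + 1 / w0" if "cmod y \<le> L" "(cmod (y - x))\<^sup>2 \<le> 1 / w0" for x y :: complex
  proof -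
    have "(cmod (y - x))\<^sup>2 \<le> (1 / w0)\<^sup>2"
      using that(2) w1 self_le_power[of "1 / w0" 2] by simp
    then have "cmod (y - x) \<le> 1 / w0" by (rule power2_le_imp_le) (use w0 in simp)
    then show ?thesis using that(1) norm_triangle_ineq4[of y "y - x"] by simp
  qed
  have "(cmod (Z t k - z t k))\<^sup>2 \<le> 1 / w0"
    using member_le_sum[OF k, of "\<lambda>k. (cmod (Z t k - z t k))\<^sup>2"] energy_terms_le(1)[OF K, of t z v] e K w1 by simp
  with cmod_le_infsum[OF Z_abs(1)[OF t], of k] Z_abs(2)[OF t]
  show "cmod (z t k) \<le> L + 1 / w0" by (intro le[of "Z t k"]) auto
  have "energy K z v t / w0 \<le> 1 / w0" using e w0 by (simp add: divide_right_mono)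
  then have "(cmod (U t k - v t k))\<^sup>2 \<le> 1 / w0"
    using member_le_sum[OF k, of "\<lambda>k. (cmod (U t k - v t k))\<^sup>2"] energy_terms_le(3)[OF K, of t v z] K by simp
  with cmod_le_infsum[OF U_abs(1)[OF t], of k] U_abs(2)[OF t]
  show "cmod (v t k) \<le> L + 1 / w0" by (intro le[of "U t k"]) auto
qed

lemma galerkin_coeffs_exist_error:
  obtains C N0 where "C \<ge> 0" "N0 \<ge> 1"
    "\<And>N. N \<ge> N0 \<Longrightarrow> \<exists>z v. galerkin_coeffs {- int N..int N} z v"
    "\<And>N z v t. N \<ge> N0 \<Longrightarrow> galerkin_coeffs {- int N..int N} z v \<Longrightarrow> t \<in> {0..T} \<Longrightarrow>
      (\<Sum>\<^sub>\<infinity>k. (cmod (Z t k - z t k))\<^sup>2) \<le> C * (real N powr - s)\<^sup>2 \<and>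
      (\<Sum>\<^sub>\<infinity>k. (cmod (U t k - v t k))\<^sup>2) \<le> C * (real N powr - s)\<^sup>2"
proof (rule galerkin_error)
  fix C N0
  assume C: "C \<ge> 0" and N0: "N0 \<ge> 1" and err:
    "\<And>N K z v t. N \<ge> N0 \<Longrightarrow> K = {- int N..int N} \<Longrightarrow>
      (\<And>t k. t \<in> {0..T} \<Longrightarrow> k \<notin> K \<Longrightarrow> z t k = 0) \<Longrightarrow>
      (\<And>t k. t \<in> {0..T} \<Longrightarrow> k \<notin> K \<Longrightarrow> v t k = 0) \<Longrightarrow>
      (\<And>k. k \<in> K \<Longrightarrow> z 0 k = Z 0 k) \<Longrightarrow> (\<And>k. k \<in> K \<Longrightarrow> v 0 k = U 0 k) \<Longrightarrow>
      (\<And>k. k \<in> K \<Longrightarrow> continuous_on {0..T} (\<lambda>t. z t k)) \<Longrightarrow>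
      (\<And>k. k \<in> K \<Longrightarrow> continuous_on {0..T} (\<lambda>t. v t k)) \<Longrightarrow>
      (\<And>t k. k \<in> K \<Longrightarrow> t \<in> {0..T} \<Longrightarrow> energy K z v t < 1 \<Longrightarrow>
        ((\<lambda>\<tau>. z \<tau> k) has_vector_derivative
          \<i> * of_real (m k) * conv (z t) (v t) k - \<i> * of_real (p k) * v t k) (at t within {0..T})) \<Longrightarrow>
      (\<And>t k. k \<in> K \<Longrightarrow> t \<in> {0..T} \<Longrightarrow> energy K z v t < 1 \<Longrightarrow>
        ((\<lambda>\<tau>. v \<tau> k) has_vector_derivative
          \<i> * of_real (n k) * conv (v t) (v t) k - \<i> * of_real (r k) * z t k) (at t within {0..T})) \<Longrightarrow>
      t \<in> {0..T} \<Longrightarrow> energy K z v t < 1 \<and> energy K z v t \<le> C * (real N powr - s)\<^sup>2"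
  have cont: "continuous_on {0..T} f"
    if "\<And>t. t \<in> {0..T} \<Longrightarrow> \<exists>f'. (f has_vector_derivative f') (at t within {0..T})" for f :: "real \<Rightarrow> complex"
    using that has_vector_derivative_continuous continuous_on_eq_continuous_within by blast
  show thesis
  proof (rule that)
    show "M + C / w0 \<ge> 0" using M_nonneg C w0 by simp
    show "N0 \<ge> 1" by fact
    fix N assume N: "N \<ge> N0"
    define K where "K = {- int N..int N}"
    have fin: "finite K" by (simp add: K_def)
    {
      \<comment> \<open>\<open>R\<close> bounds the coefficients while the energy is below 1, so the truncation is never active.\<close>
      define R where "R = L + 1 / w0"
      have R: "R \<ge> 0" using L_nonneg w0 by (simp add: R_def)
      define trunc where "trunc y k = (if k \<in> K then closest_point (cball 0 R) (y k) else (0 :: complex))" for y k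
      obtain z v where supp: "\<And>t k. k \<notin> K \<Longrightarrow> z t k = 0" "\<And>t k. k \<notin> K \<Longrightarrow> v t k = 0"
        and init: "\<And>k. k \<in> K \<Longrightarrow> z 0 k = Z 0 k" "\<And>k. k \<in> K \<Longrightarrow> v 0 k = U 0 k"
        and dz: "\<And>t k. k \<in> K \<Longrightarrow> t \<in> {0..T} \<Longrightarrow> ((\<lambda>\<tau>. z \<tau> k) has_vector_derivative
            \<i> * of_real (m k) * conv (trunc (z t)) (trunc (v t)) k - \<i> * of_real (p k) * v t k) (at t within {0..T})"
        and dv: "\<And>t k. k \<in> K \<Longrightarrow> t \<in> {0..T} \<Longrightarrow> ((\<lambda>\<tau>. v \<tau> k) has_vector_derivative
            \<i> * of_real (n k) * conv (trunc (v t)) (trunc (v t)) k - \<i> * of_real (r k) * z t k) (at t within {0..T})"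
        using truncated_galerkin_exists[where m = m and n = n and p = p and r = r and ?z0.0 = "Z 0" and ?v0.0 = "U 0", OF fin R T]
        unfolding trunc_def [abs_def] by blast
      have tr: "trunc (z t) = z t" "trunc (v t) = v t" if "t \<in> {0..T}" "energy K z v t < 1" for t
        using energy_small_imp_bounded[OF fin that] supp
        by (auto simp: trunc_def R_def fun_eq_iff intro!: closest_point_self)
      \<comment> \<open>There is no circularity: \<open>err\<close> asks for the untruncated
        equations only where the energy is below 1, where \<open>tr\<close> supplies them, and
        returns that this is so at every time.\<close>
      have small: "energy K z v t < 1" if t: "t \<in> {0..T}" for t
      proof (rule conjunct1, rule err[where z = z and v = v, OF N K_def])
        show "continuous_on {0..T} (\<lambda>t. z t k)" if "k \<in> K" for k using dz[OF that] by (intro cont) blast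
        show "continuous_on {0..T} (\<lambda>t. v t k)" if "k \<in> K" for k using dv[OF that] by (intro cont) blast
        fix t k assume a: "k \<in> K" "t \<in> {0..T}" "energy K z v t < 1"
        show "((\<lambda>\<tau>. z \<tau> k) has_vector_derivative
          \<i> * of_real (m k) * conv (z t) (v t) k - \<i> * of_real (p k) * v t k) (at t within {0..T})"
          using dz[OF a(1,2)] unfolding tr[OF a(2,3)] .
        show "((\<lambda>\<tau>. v \<tau> k) has_vector_derivative
          \<i> * of_real (n k) * conv (v t) (v t) k - \<i> * of_real (r k) * z t k) (at t within {0..T})"
          using dv[OF a(1,2)] unfolding tr[OF a(2,3)] .
      qed (use t supp init in auto)
      have "galerkin_coeffs K z v"
        unfolding galerkin_coeffs_def using supp init dz dv tr[OF _ small] by simp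
      then show "\<exists>z v. galerkin_coeffs {- int N..int N} z v" unfolding K_def by blast
    }
    fix z v t assume g: "galerkin_coeffs {- int N..int N} z v" and t: "t \<in> {0..T}"
    note g = g[folded K_def, unfolded galerkin_coeffs_def]
    have "energy K z v t \<le> C * (real N powr - s)\<^sup>2"
    proof (rule conjunct2, rule err[where z = z and v = v, OF N K_def])
      show "continuous_on {0..T} (\<lambda>t. z t k)" if "k \<in> K" for k using g that by (intro cont) blast
      show "continuous_on {0..T} (\<lambda>t. v t k)" if "k \<in> K" for k using g that by (intro cont) blast
    qed (use g t in auto)
    moreover from this have "energy K z v t / w0 \<le> C * (real N powr - s)\<^sup>2 / w0"
      using w0 by (intro divide_right_mono) auto
    moreover have "energy K z v t * w0 \<le> energy K z v t"
      using energy_terms_le(5)[OF fin, of z v t] w0 by (simp add: mult_left_le)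
    then have "energy K z v t \<le> energy K z v t / w0" using w0 by (simp add: field_simps)
    ultimately have le: "(\<Sum>k\<in>K. (cmod (Z t k - z t k))\<^sup>2) \<le> C / w0 * (real N powr - s)\<^sup>2"
      "(\<Sum>k\<in>K. (cmod (U t k - v t k))\<^sup>2) \<le> C / w0 * (real N powr - s)\<^sup>2"
      using energy_terms_le(1)[OF fin, of t z v] energy_terms_le(3)[OF fin, of t v z] by auto
    have s0: "s \<ge> 0" "N \<ge> 1" using s N N0 by auto
    have supp: "\<forall>k. k \<notin> K \<longrightarrow> z t k = 0" "\<forall>k. k \<notin> K \<longrightarrow> v t k = 0" using g t by auto
    show "(\<Sum>\<^sub>\<infinity>k. (cmod (Z t k - z t k))\<^sup>2) \<le> (M + C / w0) * (real N powr - s)\<^sup>2 \<and>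
      (\<Sum>\<^sub>\<infinity>k. (cmod (U t k - v t k))\<^sup>2) \<le> (M + C / w0) * (real N powr - s)\<^sup>2"
      using infsum_diff_le(2)[OF s0 Z_sum[OF t] Z_le[OF t] supp(1)[unfolded K_def] le(1)[unfolded K_def]]
        infsum_diff_le(2)[OF s0 U_sum[OF t] U_le[OF t] supp(2)[unfolded K_def] le(2)[unfolded K_def]]
      by (simp add: distrib_right)
  qed
qed

end

section \<open>Passage between periodic functions and coefficient sequences; the B/FD
  symbols\<close>

definition wave_number :: "int \<Rightarrow> real" where
  "wave_number k = 2 * pi * real_of_int k"

lemma wave_number_square_ge: "(real_of_int k)\<^sup>2 \<le> (wave_number k)\<^sup>2"
proof -
  have "1 \<le> (2 * pi)\<^sup>2" by (rule one_le_power) (use pi_gt3 in simp)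
  from mult_right_mono[OF this, of "(real_of_int k)\<^sup>2"]
  show ?thesis by (simp add: wave_number_def power_mult_distrib)
qed

text \<open>This and the next three symbols instantiate \<open>m\<close>, \<open>n\<close>,
  \<open>p\<close>, \<open>r\<close> of the locale, in the order \<open>zeta_mult\<close>,
  \<open>u_mult\<close>, \<open>zeta_lin\<close>, \<open>u_lin\<close>; the factor i is kept
  outside, so that they are real.\<close>

definition zeta_mult :: "real \<Rightarrow> real \<Rightarrow> int \<Rightarrow> real" where
  "zeta_mult \<gamma> b k = wave_number k / (1 + b * (wave_number k)\<^sup>2) / \<gamma>"

definition u_mult :: "real \<Rightarrow> real \<Rightarrow> int \<Rightarrow> real" where
  "u_mult \<gamma> d k = wave_number k / (1 + d * (wave_number k)\<^sup>2) / (2 * \<gamma>)"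

definition zeta_lin :: "real \<Rightarrow> real \<Rightarrow> int \<Rightarrow> real" where
  "zeta_lin \<gamma> b k = wave_number k / (1 + b * (wave_number k)\<^sup>2) * g_symbol \<gamma> 0 (wave_number k)"

definition u_lin :: "real \<Rightarrow> real \<Rightarrow> int \<Rightarrow> real" where
  "u_lin \<gamma> d k = wave_number k * (1 - \<gamma>) / (1 + d * (wave_number k)\<^sup>2)"

text \<open>Absolute summability turns the coefficients of the products into convolutions, so the
  problem involves coefficient sequences only. \<open>K\<close> is left free in order to serve the
  full problem and the Galerkin system alike.\<close>

lemma BFD_fourier_ivp_conv:
  assumes "\<forall>t\<in>{0..T}. abs_fourier (\<zeta> t) (fourier (\<zeta> t)) \<and> abs_fourier (u t) (fourier (u t))"
  shows "BFD_fourier_ivp \<gamma> 0 b 0 d K T \<zeta>\<^sub>0 u\<^sub>0 \<zeta> u \<longleftrightarrow>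
    (\<forall>k\<in>K. fourier (\<zeta> 0) k = fourier \<zeta>\<^sub>0 k \<and> fourier (u 0) k = fourier u\<^sub>0 k \<and>
      (\<forall>t\<in>{0..T}.
        ((\<lambda>\<tau>. fourier (\<zeta> \<tau>) k) has_vector_derivative
          \<i> * of_real (zeta_mult \<gamma> b k) * conv (fourier (\<zeta> t)) (fourier (u t)) k
            - \<i> * of_real (zeta_lin \<gamma> b k) * fourier (u t) k) (at t within {0..T}) \<and>
        ((\<lambda>\<tau>. fourier (u \<tau>) k) has_vector_derivative
          \<i> * of_real (u_mult \<gamma> d k) * conv (fourier (u t)) (fourier (u t)) k
            - \<i> * of_real (u_lin \<gamma> d k) * fourier (\<zeta> t) k) (at t within {0..T})))"
proof -
  have 1: "\<i> / of_real \<gamma> * of_real (wave_number k / (1 + b * (wave_number k)\<^sup>2)) = \<i> * of_real (zeta_mult \<gamma> b k)" for k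
    by (simp add: zeta_mult_def)
  have 2: "\<i> / (2 * of_real \<gamma>) * of_real (wave_number k / (1 + d * (wave_number k)\<^sup>2)) = \<i> * of_real (u_mult \<gamma> d k)" for k
    by (simp add: u_mult_def)
  have 3: "wave_number k * ((1 - \<gamma>) * (1 - 0 * (wave_number k)\<^sup>2) / (1 + d * (wave_number k)\<^sup>2)) = u_lin \<gamma> d k" for k
    by (simp add: u_lin_def)
  have 4: "fourier (\<lambda>x. \<zeta> t x * u t x) k = conv (fourier (\<zeta> t)) (fourier (u t)) k"
    "fourier (\<lambda>x. (u t x)\<^sup>2) k = conv (fourier (u t)) (fourier (u t)) k" if "t \<in> {0..T}" for t k
    using abs_fourier_mult assms that
    by (simp_all add: power2_eq_square)
  show ?thesis
    unfolding BFD_fourier_ivp_def Let_def wave_number_def [symmetric] 1 2 3 zeta_lin_def [symmetric]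
    using 4 by (intro ball_cong conj_cong refl) simp_all
qed

lemma trig_space_abs_fourier:
  assumes "f \<in> trig_space N"
  shows "abs_fourier f (fourier f)" "k \<notin> {- int N..int N} \<Longrightarrow> fourier f k = 0"
proof -
  obtain c where c: "f = (\<lambda>x. \<Sum>k\<in>{- int N..int N}. c k * fourier_mode k x)"
    using assms by (auto simp: trig_space_def)
  note af = abs_fourier_trig_space[OF c finite_atLeastAtMost_int]
  have eq: "fourier f = (\<lambda>k. if k \<in> {- int N..int N} then c k else 0)"
    using abs_fourier_coeff[OF af] by (rule ext)
  show "abs_fourier f (fourier f)" unfolding eq by (rule af)
  show "k \<notin> {- int N..int N} \<Longrightarrow> fourier f k = 0" unfolding eq by auto
qed

lemma fourier_trig_sum:
  assumes "finite K"
  shows "fourier (\<lambda>x. \<Sum>k\<in>K. c k * fourier_mode k x) k = (if k \<in> K then c k else 0)"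
  by (rule abs_fourier_coeff[OF abs_fourier_trig_space[OF refl assms]])

lemma L2_norm_diff_le:
  assumes f: "abs_fourier f (fourier f)" and g: "abs_fourier g (fourier g)"
    and le: "(\<Sum>\<^sub>\<infinity>k. (cmod (fourier g k - fourier f k))\<^sup>2) \<le> C * e\<^sup>2" and "e \<ge> 0"
  shows "L2_norm (\<lambda>x. f x - g x) \<le> sqrt C * e"
proof -
  have "(L2_norm (\<lambda>x. f x - g x))\<^sup>2 \<le> C * e\<^sup>2"
    using abs_fourier_L2_norm(2)[OF abs_fourier_diff[OF f g]] le by (simp add: norm_minus_commute)
  from real_le_rsqrt[OF this] show ?thesis using \<open>e \<ge> 0\<close> by (simp add: real_sqrt_mult)
qed

theorem proposition2p1:
  fixes \<gamma> T \<alpha>\<^sub>1 \<alpha>\<^sub>2 \<beta> a b c d \<mu> :: real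
    and \<zeta>\<^sub>0 u\<^sub>0 :: "real \<Rightarrow> real"
    and \<zeta> u :: "real \<Rightarrow> real \<Rightarrow> real"
  assumes "0 < \<gamma>" "\<gamma> < 1" "T > 0"
    and "\<alpha>\<^sub>1 \<ge> 0" "\<alpha>\<^sub>2 \<le> 1" "\<beta> \<ge> 0"
    and "a = (1 - \<alpha>\<^sub>1 - 3 * \<beta>) / 3" "b = \<alpha>\<^sub>1 / 3" "c = \<beta> * \<alpha>\<^sub>2" "d = \<beta> * (1 - \<alpha>\<^sub>2)"
    and "b > 0" "d > 0" "a = 0" "c = 0"
    and "\<mu> \<ge> 1"
    and "periodic_L2 (\<lambda>x. of_real (\<zeta>\<^sub>0 x))" "periodic_L2 (\<lambda>x. of_real (u\<^sub>0 x))"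
    and "BFD_unique_solution \<gamma> a b c d \<mu> T \<zeta>\<^sub>0 u\<^sub>0 \<zeta> u"
  shows "\<exists>N\<^sub>0\<ge>1. \<exists>C::real. \<forall>N\<ge>N\<^sub>0.
           (\<exists>\<zeta>\<^sub>N u\<^sub>N. galerkin_solution \<gamma> a b c d N T \<zeta>\<^sub>0 u\<^sub>0 \<zeta>\<^sub>N u\<^sub>N) \<and>
           (\<forall>\<zeta>\<^sub>N u\<^sub>N. galerkin_solution \<gamma> a b c d N T \<zeta>\<^sub>0 u\<^sub>0 \<zeta>\<^sub>N u\<^sub>N \<longrightarrow>
              (\<forall>t\<in>{0..T}.
                 L2_norm (\<lambda>x. \<zeta>\<^sub>N t x - of_real (\<zeta> t x)) + L2_norm (\<lambda>x. u\<^sub>N t x - of_real (u t x))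
                   \<le> C * real N powr (- \<mu>)))"
proof -
  note \<gamma> = \<open>0 < \<gamma>\<close> \<open>\<gamma> < 1\<close> and bd = \<open>b > 0\<close> \<open>d > 0\<close>
  have T: "T > 0" and \<mu>: "\<mu> \<ge> 1" and ac: "a = 0" "c = 0" by fact+
  define \<zeta>' where "\<zeta>' t x = complex_of_real (\<zeta> t x)" for t x
  define u' where "u' t x = complex_of_real (u t x)" for t x
  have "BFD_solution \<gamma> 0 b 0 d \<mu> T \<zeta>\<^sub>0 u\<^sub>0 \<zeta> u"
    using assms unfolding BFD_unique_solution_def by simp
  then have c\<zeta>: "continuous_in_sobolev T \<mu> \<zeta>'" and cu: "continuous_in_sobolev T \<mu> u'"
    and ivp: "BFD_fourier_ivp \<gamma> 0 b 0 d UNIV T (\<lambda>x. of_real (\<zeta>\<^sub>0 x)) (\<lambda>x. of_real (u\<^sub>0 x)) \<zeta>' u'"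
    unfolding BFD_solution_def \<zeta>'_def [abs_def] u'_def [abs_def] by auto
  have sob: "\<zeta>' t \<in> sobolev \<mu>" "u' t \<in> sobolev \<mu>" if "t \<in> {0..T}" for t
    using c\<zeta> cu that by (auto simp: continuous_in_sobolev_def)
  have af: "\<forall>t\<in>{0..T}. abs_fourier (\<zeta>' t) (fourier (\<zeta>' t)) \<and> abs_fourier (u' t) (fourier (u' t))"
    using sobolev_abs_fourier[OF \<mu>] sob by blast
  note ivp' = ivp[unfolded BFD_fourier_ivp_conv[OF af], simplified]
  obtain M1 where M1: "\<And>t. t \<in> {0..T} \<Longrightarrow>
      (\<Sum>\<^sub>\<infinity>k::int. (1 + (of_int k)\<^sup>2) powr \<mu> * (cmod (fourier (\<zeta>' t) k))\<^sup>2) \<le> M1"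
    using sobolev_norm_bounded[OF c\<zeta>] by blast
  obtain M2 where M2: "\<And>t. t \<in> {0..T} \<Longrightarrow>
      (\<Sum>\<^sub>\<infinity>k::int. (1 + (of_int k)\<^sup>2) powr \<mu> * (cmod (fourier (u' t) k))\<^sup>2) \<le> M2"
    using sobolev_norm_bounded[OF cu] by blast
  define w where "w k = energy_weight \<gamma> b d (wave_number k)" for k
  define w0 where "w0 = min 1 (d / b) / 2"
  define m0 where "m0 = (1 + 1 / b) / \<gamma>"
  \<comment> \<open>The square of the constant \<open>n0\<close> of the locale: the bound of
    \<open>energy_weight_mult_le\<close>, divided by the square of the 2\<gamma> in
    \<open>u_mult\<close>.\<close>
  define n2 where "n2 = 5 / \<gamma>^3 * (1 + 1 / b) / d / (1 - \<gamma>) / (2 * \<gamma>)\<^sup>2"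
  have w0: "0 < w0" "w0 \<le> 1" using bd by (auto simp: w0_def)
  interpret dispersive_system "\<lambda>t. fourier (\<zeta>' t)" "\<lambda>t. fourier (u' t)"
    "zeta_mult \<gamma> b" "u_mult \<gamma> d" "zeta_lin \<gamma> b" "u_lin \<gamma> d" w T \<mu> "max M1 M2" w0 m0 "sqrt n2"
  proof
    show "\<mu> \<ge> 1" "T > 0" "0 < w0" "w0 \<le> 1" by fact+
    show "m0 \<ge> 0" "sqrt n2 \<ge> 0" using \<gamma> bd by (auto simp: m0_def n2_def)
    fix k
    \<comment> \<open>The locale weighs by k, the symbols by \<kappa> = 2 pi k, and \<kappa>^2 >=
      k^2.\<close>
    have "w0 * (1 + (of_int k)\<^sup>2) \<le> w0 * (1 + (wave_number k)\<^sup>2)"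
      using w0 wave_number_square_ge by simp
    also have "\<dots> \<le> w k" unfolding w_def w0_def by (rule energy_weight_ge[OF \<gamma> bd])
    finally show "w0 * (1 + (of_int k)\<^sup>2) \<le> w k" .
    have "\<bar>wave_number k / (1 + b * (wave_number k)\<^sup>2)\<bar> / \<gamma> \<le> (1 + 1 / b) / \<gamma>"
      using \<gamma> by (intro divide_right_mono bbm_multiplier_le bd) auto
    moreover have "\<bar>zeta_mult \<gamma> b k\<bar> = \<bar>wave_number k / (1 + b * (wave_number k)\<^sup>2)\<bar> / \<gamma>"
      unfolding zeta_mult_def abs_divide[of _ \<gamma>] using \<gamma> by simp
    ultimately show "\<bar>zeta_mult \<gamma> b k\<bar> \<le> m0" by (simp add: m0_def)
    have "w k * (wave_number k / (1 + d * (wave_number k)\<^sup>2))\<^sup>2 / (2 * \<gamma>)\<^sup>2 \<le> n2"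
      unfolding w_def n2_def by (intro divide_right_mono energy_weight_mult_le \<gamma> bd) simp
    moreover have "n2 \<ge> 0" using \<gamma> bd by (simp add: n2_def)
    ultimately show "w k * (u_mult \<gamma> d k)\<^sup>2 \<le> (sqrt n2)\<^sup>2" by (simp add: u_mult_def power_divide power_mult_distrib)
    have "1 + d * (wave_number k)\<^sup>2 > 0" using bd by (simp add: add_pos_nonneg)
    then show "zeta_lin \<gamma> b k = w k * u_lin \<gamma> d k"
      using \<gamma> by (simp add: zeta_lin_def w_def u_lin_def energy_weight_def)
  next
    fix t assume t: "t \<in> {0..T}"
    show "(\<lambda>k::int. (1 + (of_int k)\<^sup>2) powr \<mu> * (cmod (fourier (\<zeta>' t) k))\<^sup>2) summable_on UNIV"
      "(\<lambda>k::int. (1 + (of_int k)\<^sup>2) powr \<mu> * (cmod (fourier (u' t) k))\<^sup>2) summable_on UNIV"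
      using sob[OF t] by (auto simp: sobolev_def)
    show "(\<Sum>\<^sub>\<infinity>k::int. (1 + (of_int k)\<^sup>2) powr \<mu> * (cmod (fourier (\<zeta>' t) k))\<^sup>2) \<le> max M1 M2"
      "(\<Sum>\<^sub>\<infinity>k::int. (1 + (of_int k)\<^sup>2) powr \<mu> * (cmod (fourier (u' t) k))\<^sup>2) \<le> max M1 M2"
      using M1[OF t] M2[OF t] by auto
    fix k
    show "((\<lambda>\<tau>. fourier (\<zeta>' \<tau>) k) has_vector_derivative
          \<i> * of_real (zeta_mult \<gamma> b k) * conv (fourier (\<zeta>' t)) (fourier (u' t)) k
            - \<i> * of_real (zeta_lin \<gamma> b k) * fourier (u' t) k) (at t within {0..T})"
      "((\<lambda>\<tau>. fourier (u' \<tau>) k) has_vector_derivative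
          \<i> * of_real (u_mult \<gamma> d k) * conv (fourier (u' t)) (fourier (u' t)) k
            - \<i> * of_real (u_lin \<gamma> d k) * fourier (\<zeta>' t) k) (at t within {0..T})"
      using ivp' t by auto
  qed
  have init: "fourier (\<zeta>' 0) k = fourier (\<lambda>x. of_real (\<zeta>\<^sub>0 x)) k" "fourier (u' 0) k = fourier (\<lambda>x. of_real (u\<^sub>0 x)) k" for k
    using ivp' by auto
  obtain C N0 where C: "C \<ge> 0" and N0: "N0 \<ge> 1"
    and ex: "\<And>N. N \<ge> N0 \<Longrightarrow> \<exists>z v. galerkin_coeffs {- int N..int N} z v"
    and err: "\<And>N z v t. N \<ge> N0 \<Longrightarrow> galerkin_coeffs {- int N..int N} z v \<Longrightarrow> t \<in> {0..T} \<Longrightarrow>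
      (\<Sum>\<^sub>\<infinity>k. (cmod (fourier (\<zeta>' t) k - z t k))\<^sup>2) \<le> C * (real N powr - \<mu>)\<^sup>2 \<and>
      (\<Sum>\<^sub>\<infinity>k. (cmod (fourier (u' t) k - v t k))\<^sup>2) \<le> C * (real N powr - \<mu>)\<^sup>2"
    using galerkin_coeffs_exist_error by blast
  \<comment> \<open>For unknowns in the trigonometric space the formulations by functions and by
    coefficients say the same; \<open>init\<close> exchanges the initial data for the exact solution
    at time 0.\<close>
  have galerkin_iff: "galerkin_solution \<gamma> a b c d N T \<zeta>\<^sub>0 u\<^sub>0 \<zeta>\<^sub>N u\<^sub>N \<longleftrightarrow>
      galerkin_coeffs {- int N..int N} (\<lambda>t. fourier (\<zeta>\<^sub>N t)) (\<lambda>t. fourier (u\<^sub>N t))"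
    if ts: "\<And>t. t \<in> {0..T} \<Longrightarrow> \<zeta>\<^sub>N t \<in> trig_space N" "\<And>t. t \<in> {0..T} \<Longrightarrow> u\<^sub>N t \<in> trig_space N" for N \<zeta>\<^sub>N u\<^sub>N
  proof -
    have af: "\<forall>t\<in>{0..T}. abs_fourier (\<zeta>\<^sub>N t) (fourier (\<zeta>\<^sub>N t)) \<and> abs_fourier (u\<^sub>N t) (fourier (u\<^sub>N t))"
      using ts trig_space_abs_fourier(1) by blast
    have "\<forall>t\<in>{0..T}. \<forall>k. k \<notin> {- int N..int N} \<longrightarrow> fourier (\<zeta>\<^sub>N t) k = 0 \<and> fourier (u\<^sub>N t) k = 0"
      using ts trig_space_abs_fourier(2) by blast
    then show ?thesis
      unfolding galerkin_solution_def ac BFD_fourier_ivp_conv[OF af] galerkin_coeffs_def init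
      using ts by blast
  qed
  show ?thesis
  \<comment> \<open>One \<open>sqrt C\<close> for each of the two norms.\<close>
  proof (intro exI[of _ N0] conjI exI[of _ "2 * sqrt C"] allI impI ballI)
    show "N0 \<ge> 1" by fact
    fix N assume N: "N \<ge> N0"
    let ?K = "{- int N..int N}"
    obtain z v where zv: "galerkin_coeffs ?K z v" using ex[OF N] by blast
    define \<zeta>\<^sub>N where "\<zeta>\<^sub>N t = (\<lambda>x. \<Sum>k\<in>?K. z t k * fourier_mode k x)" for t
    define u\<^sub>N where "u\<^sub>N t = (\<lambda>x. \<Sum>k\<in>?K. v t k * fourier_mode k x)" for t
    have ts: "\<zeta>\<^sub>N t \<in> trig_space N" "u\<^sub>N t \<in> trig_space N" for t
      unfolding \<zeta>\<^sub>N_def u\<^sub>N_def trig_space_def by blast+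
    have coeff: "fourier (\<zeta>\<^sub>N t) k = (if k \<in> ?K then z t k else 0)" "fourier (u\<^sub>N t) k = (if k \<in> ?K then v t k else 0)" for t k
      unfolding \<zeta>\<^sub>N_def u\<^sub>N_def by (simp_all add: fourier_trig_sum)
    \<comment> \<open>Holds on [0,T] only, since \<open>z\<close> and \<open>v\<close> are
      unconstrained off \<open>K\<close> at other times; the functions of time that are
      differentiated are therefore rewritten for a fixed k in \<open>K\<close>, in
      \<open>eq\<close>.\<close>
    have coeff': "fourier (\<zeta>\<^sub>N t) = z t" "fourier (u\<^sub>N t) = v t" if "t \<in> {0..T}" for t
      using zv that by (auto simp: coeff galerkin_coeffs_def fun_eq_iff)
    have "galerkin_coeffs ?K (\<lambda>t. fourier (\<zeta>\<^sub>N t)) (\<lambda>t. fourier (u\<^sub>N t))"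
      unfolding galerkin_coeffs_def
    proof (intro conjI ballI allI impI)
      fix k t assume k: "k \<in> ?K" and t: "t \<in> {0..T}"
      have eq: "(\<lambda>\<tau>. fourier (\<zeta>\<^sub>N \<tau>) k) = (\<lambda>\<tau>. z \<tau> k)" "(\<lambda>\<tau>. fourier (u\<^sub>N \<tau>) k) = (\<lambda>\<tau>. v \<tau> k)"
        using k by (simp_all add: coeff)
      show "((\<lambda>\<tau>. fourier (\<zeta>\<^sub>N \<tau>) k) has_vector_derivative
          \<i> * of_real (zeta_mult \<gamma> b k) * conv (fourier (\<zeta>\<^sub>N t)) (fourier (u\<^sub>N t)) k
            - \<i> * of_real (zeta_lin \<gamma> b k) * fourier (u\<^sub>N t) k) (at t within {0..T})"
        "((\<lambda>\<tau>. fourier (u\<^sub>N \<tau>) k) has_vector_derivative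
          \<i> * of_real (u_mult \<gamma> d k) * conv (fourier (u\<^sub>N t)) (fourier (u\<^sub>N t)) k
            - \<i> * of_real (u_lin \<gamma> d k) * fourier (\<zeta>\<^sub>N t) k) (at t within {0..T})"
        unfolding eq coeff'[OF t] using zv k t unfolding galerkin_coeffs_def by blast+
    qed (use zv in \<open>auto simp: coeff galerkin_coeffs_def\<close>)
    then show "\<exists>\<zeta>\<^sub>N u\<^sub>N. galerkin_solution \<gamma> a b c d N T \<zeta>\<^sub>0 u\<^sub>0 \<zeta>\<^sub>N u\<^sub>N"
      using galerkin_iff[of \<zeta>\<^sub>N N u\<^sub>N] ts by blast
  next
    fix N \<zeta>\<^sub>N u\<^sub>N t
    assume N: "N \<ge> N0" and g: "galerkin_solution \<gamma> a b c d N T \<zeta>\<^sub>0 u\<^sub>0 \<zeta>\<^sub>N u\<^sub>N" and t: "t \<in> {0..T}"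
    have ts: "\<zeta>\<^sub>N t \<in> trig_space N" "u\<^sub>N t \<in> trig_space N" if "t \<in> {0..T}" for t
      using g that by (auto simp: galerkin_solution_def)
    have "galerkin_coeffs {- int N..int N} (\<lambda>t. fourier (\<zeta>\<^sub>N t)) (\<lambda>t. fourier (u\<^sub>N t))"
      using galerkin_iff[of \<zeta>\<^sub>N N u\<^sub>N] ts g by blast
    from err[OF N this t] trig_space_abs_fourier(1)[OF ts(1)[OF t]] trig_space_abs_fourier(1)[OF ts(2)[OF t]] bspec[OF af t]
    have "L2_norm (\<lambda>x. \<zeta>\<^sub>N t x - \<zeta>' t x) \<le> sqrt C * real N powr - \<mu>"
      "L2_norm (\<lambda>x. u\<^sub>N t x - u' t x) \<le> sqrt C * real N powr - \<mu>"
      by (auto intro!: L2_norm_diff_le)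
    then show "L2_norm (\<lambda>x. \<zeta>\<^sub>N t x - of_real (\<zeta> t x)) + L2_norm (\<lambda>x. u\<^sub>N t x - of_real (u t x))
      \<le> 2 * sqrt C * real N powr (- \<mu>)"
      unfolding \<zeta>'_def u'_def by linarith
  qed
qed

end
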